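(* Let $(X_n)_{n\ge0}$ be an irreducible aperiodic positive Markov chain on $\mathcal{S}$ with stationary distribution $\pi$. Assume that there exists a constant $M_0>0$ such that, for every $n\in\mathbb{N}$, every measurable function $K:\mathcal{S}^n\to\mathbb{R}$ which is separately bounded with constants $L_0,\dots,L_{n-1}\ge0$, and every $t>0$, $$\mathbb{P}_{\pi}\bigl(|K(X_0,\dots,X_{n-1})-\mathbb{E}_\pi K(X_0,\dots,X_{n-1})|>t\bigr)\le 2\exp\Bigl(-\frac{M_0^{-1}t^2}{\sum_{i=0}^{n-1} L_i^2}\Bigr).$$ Then the chain is geometrically ergodic.
   Context: $\mathcal{S}$ is a general state space (a measurable space with countably generated $\sigma$-algebra) and $P(x,A)$ is a measurable transition kernel on $\mathcal{S}$, with $n$-step kernel $P^n$. $\mathbb{P}_x,\mathbb{E}_x$ (resp. $\mathbb{P}_\pi,\mathbb{E}_\pi$) denote probability and expectation for the Markov chain $(X_n)_{n\ge0}$ with kernel $P$ started from $X_0=x$ (resp. $X_0\sim\pi$). Irreducible, aperiodic and positive: there exists a (necessarily unique) stationary probability measure $\pi$ such that, for all $x\in\mathcal{S}$, all measurable $A$ with $\pi(A)>0$, and all large enough $n$ (depending on $x$ and $A$), one has $P^n(x,A)>0$. Geometrically ergodic: an irreducible aperiodic positive chain is geometrically ergodic if there exist a nonempty measurable set $C\subset\mathcal{S}$, an integer $m>0$, a probability measure $\nu$ on $\mathcal{S}$, and $\delta\in(0,1)$, $\kappa>1$ such that (i) for all $x\in C$, $P^m(x,\cdot)\ge\delta\nu$;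 (ii) $\sup_{x\in C}\mathbb{E}_x(\kappa^{\tau_C})<\infty$, where $\tau_C=\inf\{n\ge1: X_n\in C\}$ is the return time to $C$. Separately bounded: $K:\mathcal{S}^n\to\mathbb{R}$ is separately bounded with constants $L_i$ if for every $i$ and all $x_0,\dots,x_{n-1},x_i'\in\mathcal{S}$, $$|K(x_0,\dots,x_{i-1},x_i,x_{i+1},\dots,x_{n-1})-K(x_0,\dots,x_{i-1},x_i',x_{i+1},\dots,x_{n-1})|\le L_i.$$ If $\sum L_i^2=0$, the right-hand side is interpreted as $0$. *)

theory Defs
  imports "HOL-Probability.Probability"
begin

text \<open>
  The state space is a measure \<open>M\<close> of which only \<open>space M\<close> and \<open>sets M\<close> matter; a Markov
  transition kernel on it is a map in \<open>M \<rightarrow>\<^sub>M prob_algebra M\<close>.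
\<close>

definition countably_generated_space :: "'a measure \<Rightarrow> bool" where
  "countably_generated_space M \<longleftrightarrow>
     (\<exists>G. countable G \<and> G \<subseteq> Pow (space M) \<and> sets M = sigma_sets (space M) G)"

primrec kernel_power :: "'a measure \<Rightarrow> ('a \<Rightarrow> 'a measure) \<Rightarrow> nat \<Rightarrow> 'a \<Rightarrow> 'a measure" where
  "kernel_power M P 0 x = return M x"
| "kernel_power M P (Suc n) x = kernel_power M P n x \<bind> P"

text \<open>
  The conditional law of \<open>X\<^sub>i\<close> given the trajectory \<open>\<omega>\<close> up to time \<open>i - 1\<close>, for initial law \<open>\<mu>\<close>.
\<close>

fun chain_step :: "('a \<Rightarrow> 'a measure) \<Rightarrow> 'a measure \<Rightarrow> nat \<Rightarrow> (nat \<Rightarrow> 'a) \<Rightarrow> 'a measure" where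
  "chain_step P \<mu> 0 \<omega> = \<mu>"
| "chain_step P \<mu> (Suc i) \<omega> = P (\<omega> i)"

lemma Ionescu_Tulcea_chain_step:
  assumes P: "P \<in> M \<rightarrow>\<^sub>M prob_algebra M" and \<mu>: "\<mu> \<in> space (prob_algebra M)"
  shows "Ionescu_Tulcea (chain_step P \<mu>) (\<lambda>_. M)"
proof -
  have *: "chain_step P \<mu> i \<in> PiM {0..<i} (\<lambda>_. M) \<rightarrow>\<^sub>M prob_algebra M" for i
  proof (cases i)
    case 0
    then have "chain_step P \<mu> i = (\<lambda>_. \<mu>)"
      by auto
    then show ?thesis
      using \<mu> by simp
  next
    case (Suc j)
    then have "chain_step P \<mu> i = (\<lambda>\<omega>. P (\<omega> j))"
      by auto
    moreover have "(\<lambda>\<omega>. \<omega> j) \<in> PiM {0..<i} (\<lambda>_. M) \<rightarrow>\<^sub>M M"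
      using Suc by (intro measurable_component_singleton) auto
    ultimately show ?thesis
      using P by simp
  qed
  show ?thesis
  proof (rule Ionescu_Tulcea.intro)
    show "chain_step P \<mu> i \<in> PiM {0..<i} (\<lambda>_. M) \<rightarrow>\<^sub>M subprob_algebra M" for i
      by (rule measurable_prob_algebraD[OF *])
    show "prob_space (chain_step P \<mu> i \<omega>)" if "\<omega> \<in> space (PiM {0..<i} (\<lambda>_. M))" for i \<omega>
      using measurable_space[OF * that] by (simp add: space_prob_algebra)
  qed
qed

text \<open>
  The law of \<open>(X\<^sub>n)\<close> with \<open>X\<^sub>0\<close> distributed as \<open>\<mu>\<close>, on the trajectory space \<open>PiM UNIV (\<lambda>_. M)\<close>,
  where \<open>X\<^sub>n\<close> is the coordinate \<open>\<omega> n\<close>. It is the limit measure \<open>PF.lim\<close> of the Ionescu-Tulcea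
  theorem, whose hypotheses hold by the preceding lemma.
\<close>

definition chain_law ::
    "'a measure \<Rightarrow> ('a \<Rightarrow> 'a measure) \<Rightarrow> 'a measure \<Rightarrow> (nat \<Rightarrow> 'a) measure" where
  "chain_law M P \<mu> =
     projective_family.lim UNIV (Ionescu_Tulcea.CI (chain_step P \<mu>) (\<lambda>_. M)) (\<lambda>_. M)"

definition chain_law_from ::
    "'a measure \<Rightarrow> ('a \<Rightarrow> 'a measure) \<Rightarrow> 'a \<Rightarrow> (nat \<Rightarrow> 'a) measure" where
  "chain_law_from M P x = chain_law M P (return M x)"

definition irreducible_aperiodic_positive ::
    "'a measure \<Rightarrow> ('a \<Rightarrow> 'a measure) \<Rightarrow> 'a measure \<Rightarrow> bool" where
  "irreducible_aperiodic_positive M P \<pi> \<longleftrightarrow>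
     \<pi> \<in> space (prob_algebra M) \<and> \<pi> \<bind> P = \<pi> \<and>
     (\<forall>x\<in>space M. \<forall>A\<in>sets M. emeasure \<pi> A > 0 \<longrightarrow>
        (\<forall>\<^sub>F n in sequentially. emeasure (kernel_power M P n x) A > 0))"

definition return_time :: "'a set \<Rightarrow> (nat \<Rightarrow> 'a) \<Rightarrow> enat" where
  "return_time C \<omega> = Inf {enat n | n. n \<ge> 1 \<and> \<omega> n \<in> C}"

definition power_enat :: "real \<Rightarrow> enat \<Rightarrow> ennreal" where
  "power_enat \<kappa> \<tau> = (case \<tau> of enat k \<Rightarrow> ennreal (\<kappa> ^ k) | \<infinity> \<Rightarrow> \<infinity>)"

definition geometrically_ergodic :: "'a measure \<Rightarrow> ('a \<Rightarrow> 'a measure) \<Rightarrow> bool" where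
  "geometrically_ergodic M P \<longleftrightarrow>
     (\<exists>\<pi>. irreducible_aperiodic_positive M P \<pi>) \<and>
     (\<exists>C m \<nu> \<delta> \<kappa>.
        C \<in> sets M \<and> C \<noteq> {} \<and> 0 < m \<and> \<nu> \<in> space (prob_algebra M) \<and>
        0 < \<delta> \<and> \<delta> < 1 \<and> 1 < \<kappa> \<and>
        (\<forall>x\<in>C. \<forall>A\<in>sets M. emeasure (kernel_power M P m x) A \<ge> ennreal \<delta> * emeasure \<nu> A) \<and>
        (SUP x\<in>C. \<integral>\<^sup>+ \<omega>. power_enat \<kappa> (return_time C \<omega>) \<partial>chain_law_from M P x) < \<infinity>)"

definition separately_bounded ::
    "'a measure \<Rightarrow> nat \<Rightarrow> ((nat \<Rightarrow> 'a) \<Rightarrow> real) \<Rightarrow> (nat \<Rightarrow> real) \<Rightarrow> bool" where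
  "separately_bounded M n K L \<longleftrightarrow>
     (\<forall>i<n. \<forall>x\<in>space (PiM {..<n} (\<lambda>_. M)). \<forall>y\<in>space M. \<bar>K x - K (x(i := y))\<bar> \<le> L i)"

end

theory Submission
  imports Defs
begin

text \<open>
  There is a set \<open>C\<close> with \<open>\<pi>(C) > 0\<close> and \<open>P\<^sup>m(x, \<cdot>) \<ge> \<delta> \<nu>\<close> on \<open>C\<close>. Applied to the number of visits
  to \<open>C\<close> at the first \<open>k\<close> multiples of \<open>m\<close>, the concentration inequality shows that this number is
  below half its mean with probability exponentially small in \<open>k\<close>. Each visit is a regeneration
  with probability \<open>\<delta>\<close>, so the regeneration time of the split chain has an exponential tail
  under \<open>\<pi>\<close>. The exponential moment \<open>h\<close> of the regeneration time satisfies
  \<open>\<kappa> P\<^sup>m h \<le> h + b\<close>, hence \<open>V = \<Sum>j<m. \<kappa>\<^bsup>j/m\<^esup> P\<^sup>j h\<close> satisfies a geometric drift condition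
  for \<open>P\<close> outside its large sublevel sets. These are small, because from each of their
  points a regeneration occurs within a bounded time with probability at least \<open>1/2\<close>. Replacing
  \<open>C\<close> by a sublevel set of \<open>V\<close> is necessary, since \<open>h\<close> need not be bounded on \<open>C\<close>.
\<close>

subsection \<open>Approximation by a countable generating algebra\<close>

text \<open>The split chain is never constructed. It enters only through the operator f -> P^m f -
  \<delta> 1_C \<nu>(f), and \<open>residual k\<close> is its k-th iterate on the constant 1.
  Functions take values in \<open>ennreal\<close>, so identities are arranged additively and a term
  is cancelled only once it is known to be finite.

  A part of the product space on which P^n has a density bounded below need not contain a rectangle
  of positive measure, so a small set cannot be read off from it. Composing two such steps replaces
  the indicator of a part by x, z -> \<pi>(B_x \<inter> B'_z), which varies continuously with the
  two sections and is thus bounded below on a rectangle.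

  Sampling at multiples of m makes every visit a chance to regenerate, and only k coordinates matter
  for k samples. The squared constants sum to k, so a deviation proportional to k has probability
  exponentially small in k.

  A regeneration happens at a random time, whereas smallness asks for one fixed number of steps.
  This gap is closed by aperiodicity: started from \<nu>, the chain can be in \<open>C\<close> at
  every large time.\<close>

primrec algebra_level :: "'a set \<Rightarrow> 'a set set \<Rightarrow> nat \<Rightarrow> 'a set set" where
  "algebra_level \<Omega> G 0 = insert {} G"
| "algebra_level \<Omega> G (Suc n) = algebra_level \<Omega> G n \<union> (\<lambda>A. \<Omega> - A) ` algebra_level \<Omega> G n
     \<union> (\<lambda>(A, B). A \<union> B) ` (algebra_level \<Omega> G n \<times> algebra_level \<Omega> G n)"

text \<open>Countability matters because inequalities that hold almost everywhere for each set of
  \<open>W\<close> then hold almost everywhere for all of them at once. The algebra property is what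
  permits approximation of arbitrary measurable sets.\<close>

lemma countable_generating_algebra:
  assumes "countable G" "G \<subseteq> Pow \<Omega>"
  obtains W where "countable W" "algebra \<Omega> W" "G \<subseteq> W" "sigma_sets \<Omega> W = sigma_sets \<Omega> G"
proof
  define W where "W = (\<Union>n. algebra_level \<Omega> G n)"
  have "countable (algebra_level \<Omega> G n)" for n
    using assms(1) by (induction n) auto
  then show "countable W" unfolding W_def by auto
  have mono: "m \<le> n \<Longrightarrow> algebra_level \<Omega> G m \<subseteq> algebra_level \<Omega> G n" for m n
    by (rule lift_Suc_mono_le[of "algebra_level \<Omega> G"]) auto
  have sub: "algebra_level \<Omega> G n \<subseteq> sigma_sets \<Omega> G" for n
    by (induction n) (auto intro: sigma_sets.intros sigma_sets_Un)
  show "G \<subseteq> W" unfolding W_def by (auto intro!: exI[of _ 0])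
  have W_sub: "W \<subseteq> sigma_sets \<Omega> G" unfolding W_def using sub by auto
  then have W_Pow: "W \<subseteq> Pow \<Omega>" using sigma_sets_into_sp[OF assms(2)] by blast
  show "algebra \<Omega> W"
    unfolding algebra_iff_Un
  proof (intro conjI ballI)
    show "W \<subseteq> Pow \<Omega>" by fact
    show "{} \<in> W" unfolding W_def by (auto intro!: exI[of _ 0])
    show "\<Omega> - a \<in> W" if "a \<in> W" for a
    proof -
      from that obtain n where "a \<in> algebra_level \<Omega> G n" unfolding W_def by auto
      then have "\<Omega> - a \<in> algebra_level \<Omega> G (Suc n)" by auto
      then show ?thesis unfolding W_def by blast
    qed
    show "a \<union> b \<in> W" if "a \<in> W" "b \<in> W" for a b
    proof -
      from that obtain m n where "a \<in> algebra_level \<Omega> G m" "b \<in> algebra_level \<Omega> G n"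
        unfolding W_def by auto
      then have "a \<in> algebra_level \<Omega> G (max m n)" "b \<in> algebra_level \<Omega> G (max m n)"
        using mono[of m "max m n"] mono[of n "max m n"] by auto
      then have "a \<union> b \<in> algebra_level \<Omega> G (Suc (max m n))" by force
      then show ?thesis unfolding W_def by blast
    qed
  qed
  show "sigma_sets \<Omega> W = sigma_sets \<Omega> G"
    using W_sub \<open>G \<subseteq> W\<close> by (meson sigma_sets_mono sigma_sets_mono' subset_antisym)
qed

lemma (in finite_measure) finite_union_approx:
  fixes A :: "nat \<Rightarrow> 'a set"
  assumes "range A \<subseteq> sets M" "0 < (e::real)"
  shows "\<forall>\<^sub>F n in sequentially. measure M ((\<Union>i. A i) - (\<Union>i<n. A i)) < e"
proof -
  have "(\<lambda>n. measure M ((\<Union>i. A i) - (\<Union>i<n. A i))) \<longlonglongrightarrow> measure M (\<Inter>n. (\<Union>i. A i) - (\<Union>i<n. A i))"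
    using assms(1) by (intro finite_Lim_measure_decseq)
      (auto simp: decseq_def intro!: sets.Diff sets.countable_UN)
  moreover have "(\<Inter>n. (\<Union>i. A i) - (\<Union>i<n. A i)) = {}" by auto
  ultimately have "(\<lambda>n. measure M ((\<Union>i. A i) - (\<Union>i<n. A i))) \<longlonglongrightarrow> 0"
    by (simp only: measure_empty)
  then show ?thesis using assms(2) by (rule order_tendstoD)
qed

text \<open>The approximation is simultaneous for two measures, so that an inequality between them
  extends from the algebra to the \<open>\<sigma>\<close>-algebra.\<close>

lemma algebra_approximation:
  assumes fin: "finite_measure N1" "finite_measure N2"
    and sN: "sets N1 = sigma_sets \<Omega> W" "sets N2 = sigma_sets \<Omega> W"
    and W: "algebra \<Omega> W"
    and A: "A \<in> sigma_sets \<Omega> W" and e: "0 < (e::real)"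
  shows "\<exists>B\<in>W. measure N1 (sym_diff A B) < e \<and> measure N2 (sym_diff A B) < e"
  using A e
proof (induction A arbitrary: e)
  interpret W: algebra \<Omega> W by fact
  interpret N1: finite_measure N1 by fact
  interpret N2: finite_measure N2 by fact
  {
    case (Basic a)
    then show ?case by (intro bexI[of _ a]) auto
  next
    case Empty
    then show ?case by (intro bexI[of _ "{}"]) auto
  next
    case (Compl a)
    then obtain B where B: "B \<in> W" "measure N1 (sym_diff a B) < e" "measure N2 (sym_diff a B) < e"
      by blast
    have "a \<subseteq> \<Omega>" using Compl(1) sigma_sets_into_sp[OF W.space_closed] by blast
    moreover have "B \<subseteq> \<Omega>" using B W.space_closed by blast
    ultimately have "sym_diff (\<Omega> - a) (\<Omega> - B) = sym_diff a B" by auto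
    then show ?case using B by (intro bexI[of _ "\<Omega> - B"]) auto
  next
    case (Union A)
    have "\<forall>\<^sub>F n in sequentially. measure N1 ((\<Union>i. A i) - (\<Union>i<n. A i)) < e/2
        \<and> measure N2 ((\<Union>i. A i) - (\<Union>i<n. A i)) < e/2"
      using Union sN
      by (intro eventually_conj N1.finite_union_approx N2.finite_union_approx) auto
    then obtain n where n: "measure N1 ((\<Union>i. A i) - (\<Union>i<n. A i)) < e/2"
        "measure N2 ((\<Union>i. A i) - (\<Union>i<n. A i)) < e/2"
      by (auto simp: eventually_sequentially)
    \<comment> \<open>The first \<open>n\<close> sets are approximated within \<open>d\<close> each,
      at a total cost of at most e/2; the other e/2 pays for the discarded tail. The
      \<open>+ 1\<close> covers \<open>n = 0\<close>.\<close>
    define d where "d = e / (2 * (n + 1))"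
    have "d > 0" using Union by (simp add: d_def)
    then have "\<forall>i. \<exists>B\<in>W. measure N1 (sym_diff (A i) B) < d \<and> measure N2 (sym_diff (A i) B) < d"
      using Union by blast
    then obtain B where B: "\<And>i. B i \<in> W" "\<And>i. measure N1 (sym_diff (A i) (B i)) < d"
       "\<And>i. measure N2 (sym_diff (A i) (B i)) < d" by metis
    let ?U = "(\<Union>i. A i) - (\<Union>i<n. A i)"
    let ?S = "sym_diff (\<Union>i. A i) (\<Union>i<n. B i)"
    have sub: "?S \<subseteq> ?U \<union> (\<Union>i<n. sym_diff (A i) (B i))"
      by blast
    have nd: "n * d \<le> e / 2" using Union by (simp add: d_def field_simps)
    have *: "measure N ?S < e" if N: "finite_measure N" and sN: "sets N = sigma_sets \<Omega> W"
      and 1: "measure N ?U < e/2" and 2: "\<And>i. measure N (sym_diff (A i) (B i)) < d" for N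
    proof -
      interpret N: finite_measure N by fact
      have AN[measurable]: "A i \<in> sets N" "B i \<in> sets N" for i
        using Union B(1) sN by (auto simp del: UN_extend_simps)
      have "measure N ?S \<le> measure N (?U \<union> (\<Union>i<n. sym_diff (A i) (B i)))"
        using sub by (intro N.finite_measure_mono) measurable
      also have "\<dots> \<le> measure N ?U + measure N (\<Union>i<n. sym_diff (A i) (B i))"
        by (intro measure_Un_le) measurable
      also have "measure N (\<Union>i<n. sym_diff (A i) (B i)) \<le> (\<Sum>i<n. measure N (sym_diff (A i) (B i)))"
        by (intro measure_UNION_le) auto
      also have "\<dots> \<le> (\<Sum>i<n. d)" using 2 by (intro sum_mono less_imp_le)
      finally show ?thesis using 1 nd by simp
    qed
    have "(\<Union>i<n. B i) \<in> W" using B(1) by (intro W.finite_UN) auto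
    with *[OF fin(1) sN(1) n(1) B(2)] *[OF fin(2) sN(2) n(2) B(3)]
    show ?case by blast
  }
qed

text \<open>The sets that satisfy an inequality between two measures are not closed under
  complements, so a Dynkin argument does not apply. Instead \<open>A\<close> is replaced by a set of
  \<open>W\<close> that is close to it for both measures.\<close>

lemma emeasure_le_of_algebra:
  assumes fin: "finite_measure N1" "finite_measure N2"
    and sN: "sets N1 = sigma_sets \<Omega> W" "sets N2 = sigma_sets \<Omega> W"
    and W: "algebra \<Omega> W"
    and le: "\<And>B. B \<in> W \<Longrightarrow> emeasure N1 B \<le> emeasure N2 B"
    and A: "A \<in> sets N1"
  shows "emeasure N1 A \<le> emeasure N2 A"
proof -
  interpret N1: finite_measure N1 by fact
  interpret N2: finite_measure N2 by fact
  have "measure N1 A \<le> measure N2 A + e" if e: "e > 0" for e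
  proof -
    obtain B where B: "B \<in> W" "measure N1 (sym_diff A B) < e/2" "measure N2 (sym_diff A B) < e/2"
      using algebra_approximation[OF fin sN W, of A "e/2"] A sN e by auto
    have [measurable]: "A \<in> sets N1" "A \<in> sets N2" "B \<in> sets N1" "B \<in> sets N2"
      using A B sN by auto
    have "measure N1 A \<le> measure N1 (B \<union> sym_diff A B)"
      by (intro N1.finite_measure_mono) auto
    also have "\<dots> \<le> measure N1 B + measure N1 (sym_diff A B)"
      by (intro measure_Un_le) measurable
    also have "measure N1 B \<le> measure N2 B"
      using le[OF B(1)] by (simp add: N1.emeasure_eq_measure N2.emeasure_eq_measure)
    also have "measure N2 B \<le> measure N2 (A \<union> sym_diff A B)"
      by (intro N2.finite_measure_mono) auto
    also have "\<dots> \<le> measure N2 A + measure N2 (sym_diff A B)"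
      by (intro measure_Un_le) measurable
    finally show ?thesis using B by simp
  qed
  then have "measure N1 A \<le> measure N2 A" by (rule field_le_epsilon)
  then show ?thesis by (simp add: N1.emeasure_eq_measure N2.emeasure_eq_measure)
qed

subsection \<open>Iterates of a Markov kernel\<close>

locale markov_kernel =
  fixes M :: "'a measure" and P :: "'a \<Rightarrow> 'a measure"
  assumes kernel[measurable]: "P \<in> M \<rightarrow>\<^sub>M prob_algebra M"
begin

lemma measurable_kernel_power[measurable]: "kernel_power M P n \<in> M \<rightarrow>\<^sub>M prob_algebra M"
proof (induction n)
  case 0
  have "kernel_power M P 0 = return M" by auto
  then show ?case by simp
next
  case (Suc n)
  have "kernel_power M P (Suc n) = (\<lambda>x. kernel_power M P n x \<bind> P)" by auto
  then show ?case using measurable_bind_prob_space[OF Suc kernel] by simp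
qed

lemma kernel_power_subprob[measurable]: "kernel_power M P n \<in> M \<rightarrow>\<^sub>M subprob_algebra M"
  by (rule measurable_prob_algebraD[OF measurable_kernel_power])

lemma
  assumes "x \<in> space M"
  shows prob_space_kernel_power: "prob_space (kernel_power M P n x)"
    and sets_kernel_power: "sets (kernel_power M P n x) = sets M"
    and space_kernel_power: "space (kernel_power M P n x) = space M"
  using measurable_space[OF measurable_kernel_power assms, of n]
  by (auto simp: space_prob_algebra dest: sets_eq_imp_space_eq)

text \<open>The operator P^n on nonnegative functions. Values in \<open>ennreal\<close> admit drift
  functions that are infinite at some points.\<close>

definition expect :: "nat \<Rightarrow> ('a \<Rightarrow> ennreal) \<Rightarrow> 'a \<Rightarrow> ennreal" where
  "expect n f x = (\<integral>\<^sup>+y. f y \<partial>kernel_power M P n x)"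

lemma measurable_expect[measurable]:
  assumes [measurable]: "f \<in> borel_measurable M"
  shows "expect n f \<in> borel_measurable M"
  unfolding expect_def by measurable

lemma expect_cong:
  "x \<in> space M \<Longrightarrow> (\<And>y. y \<in> space M \<Longrightarrow> f y = g y) \<Longrightarrow> expect n f x = expect n g x"
  unfolding expect_def by (intro nn_integral_cong) (simp add: space_kernel_power)

lemma expect_mono:
  "x \<in> space M \<Longrightarrow> (\<And>y. y \<in> space M \<Longrightarrow> f y \<le> g y) \<Longrightarrow> expect n f x \<le> expect n g x"
  unfolding expect_def by (intro nn_integral_mono) (simp add: space_kernel_power)

lemma expect_0: "x \<in> space M \<Longrightarrow> f \<in> borel_measurable M \<Longrightarrow> expect 0 f x = f x"
  unfolding expect_def by (simp add: nn_integral_return)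

lemma expect_const: "x \<in> space M \<Longrightarrow> expect n (\<lambda>_. c) x = c"
  unfolding expect_def by (simp add: prob_space.emeasure_space_1[OF prob_space_kernel_power])

lemma expect_indicator:
  "x \<in> space M \<Longrightarrow> A \<in> sets M \<Longrightarrow> expect n (indicator A) x = emeasure (kernel_power M P n x) A"
  unfolding expect_def by (simp add: sets_kernel_power)

lemma borel_measurable_kernel_power:
  "x \<in> space M \<Longrightarrow> f \<in> borel_measurable M \<Longrightarrow> f \<in> borel_measurable (kernel_power M P n x)"
  using sets_kernel_power[of x n] by (simp cong: measurable_cong_sets)

lemma expect_add:
  assumes "x \<in> space M" "f \<in> borel_measurable M" "g \<in> borel_measurable M"
  shows "expect n (\<lambda>y. f y + g y) x = expect n f x + expect n g x"
  unfolding expect_def using assms by (intro nn_integral_add borel_measurable_kernel_power)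

lemma expect_cmult:
  assumes "x \<in> space M" "f \<in> borel_measurable M"
  shows "expect n (\<lambda>y. c * f y) x = c * expect n f x"
  unfolding expect_def using assms by (intro nn_integral_cmult borel_measurable_kernel_power)

lemma expect_suminf:
  assumes "x \<in> space M" "\<And>k. f k \<in> borel_measurable M"
  shows "expect n (\<lambda>y. \<Sum>k. f k y) x = (\<Sum>k. expect n (f k) x)"
  unfolding expect_def using assms by (intro nn_integral_suminf borel_measurable_kernel_power)

lemma expect_sum:
  assumes "x \<in> space M" "\<And>k. f k \<in> borel_measurable M"
  shows "expect n (\<lambda>y. \<Sum>k\<in>I. f k y) x = (\<Sum>k\<in>I. expect n (f k) x)"
  unfolding expect_def using assms by (intro nn_integral_sum borel_measurable_kernel_power)

lemma expect_Suc:
  assumes "x \<in> space M" and [measurable]: "f \<in> borel_measurable M"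
  shows "expect (Suc n) f x = expect n (\<lambda>y. \<integral>\<^sup>+z. f z \<partial>P y) x"
proof -
  have "P \<in> kernel_power M P n x \<rightarrow>\<^sub>M subprob_algebra M"
    using sets_kernel_power[OF assms(1), of n] measurable_prob_algebraD[OF kernel]
    by (simp cong: measurable_cong_sets)
  then show ?thesis
    unfolding expect_def by (simp add: nn_integral_bind[where B=M])
qed

text \<open>Chapman-Kolmogorov in operator form. The induction is on the inner exponent because
  \<open>kernel_power\<close> adds its new step at the end, which \<open>expect_Suc\<close> turns
  into an application of \<open>P\<close> to \<open>f\<close>.\<close>

lemma expect_expect:
  assumes "x \<in> space M" and [measurable]: "f \<in> borel_measurable M"
  shows "expect m (expect n f) x = expect (m + n) f x"
  using assms(2)
proof (induction n arbitrary: f)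
  case 0
  then show ?case using assms(1) by (auto simp: expect_0 intro: expect_cong)
next
  case (Suc n)
  have [measurable]: "P \<in> M \<rightarrow>\<^sub>M subprob_algebra M"
    by (rule measurable_prob_algebraD[OF kernel])
  note [measurable] = Suc(2)
  have "expect m (expect (Suc n) f) x = expect m (expect n (\<lambda>y. \<integral>\<^sup>+z. f z \<partial>P y)) x"
    using assms(1) by (intro expect_cong expect_Suc Suc) auto
  also have "\<dots> = expect (m + n) (\<lambda>y. \<integral>\<^sup>+z. f z \<partial>P y) x" by (intro Suc) measurable
  finally show ?case using expect_Suc[OF assms(1) Suc(2), of "m + n"] by simp
qed

end

locale positive_chain = markov_kernel +
  fixes \<pi> :: "'a measure"
  assumes positive: "irreducible_aperiodic_positive M P \<pi>"
begin

lemma prob_algebra_pi: "\<pi> \<in> space (prob_algebra M)"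
  using positive by (simp add: irreducible_aperiodic_positive_def)

lemma sets_pi[measurable_cong]: "sets \<pi> = sets M"
  using prob_algebra_pi by (simp add: space_prob_algebra)

lemma space_pi: "space \<pi> = space M"
  by (rule sets_eq_imp_space_eq[OF sets_pi])

sublocale pi: prob_space \<pi>
  using prob_algebra_pi by (simp add: space_prob_algebra)

lemma eventually_visits:
  "x \<in> space M \<Longrightarrow> A \<in> sets M \<Longrightarrow> emeasure \<pi> A > 0 \<Longrightarrow>
    \<forall>\<^sub>F n in sequentially. emeasure (kernel_power M P n x) A > 0"
  using positive by (simp add: irreducible_aperiodic_positive_def)

lemma nn_integral_stationary:
  assumes [measurable]: "f \<in> borel_measurable M"
  shows "(\<integral>\<^sup>+x. expect n f x \<partial>\<pi>) = (\<integral>\<^sup>+x. f x \<partial>\<pi>)"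
  using assms
proof (induction n arbitrary: f)
  case 0
  show ?case using 0 by (intro nn_integral_cong) (simp add: space_pi expect_0)
next
  case (Suc n)
  have [measurable]: "P \<in> M \<rightarrow>\<^sub>M subprob_algebra M"
    by (rule measurable_prob_algebraD[OF kernel])
  note [measurable] = Suc(2)
  have "(\<integral>\<^sup>+x. expect (Suc n) f x \<partial>\<pi>) = (\<integral>\<^sup>+x. expect n (\<lambda>y. \<integral>\<^sup>+z. f z \<partial>P y) x \<partial>\<pi>)"
    by (intro nn_integral_cong) (simp add: space_pi expect_Suc)
  also have "\<dots> = (\<integral>\<^sup>+y. \<integral>\<^sup>+z. f z \<partial>P y \<partial>\<pi>)" by (intro Suc) measurable
  also have "\<dots> = (\<integral>\<^sup>+z. f z \<partial>(\<pi> \<bind> P))"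
    by (subst nn_integral_bind[where B=M]) auto
  also have "\<pi> \<bind> P = \<pi>" using positive by (simp add: irreducible_aperiodic_positive_def)
  finally show ?case .
qed

end

subsection \<open>Existence of a small set\<close>

lemma measurable_section[measurable (raw)]:
  "B \<in> sets (M \<Otimes>\<^sub>M N) \<Longrightarrow> Pair x -` B \<in> sets N"
  by (rule sets_Pair1)

lemma measurable_emeasure_section:
  assumes "K \<in> M \<rightarrow>\<^sub>M prob_algebra N" and D: "D \<in> sets (M \<Otimes>\<^sub>M N)"
  shows "(\<lambda>x. emeasure (K x) (Pair x -` D)) \<in> borel_measurable M"
proof (rule emeasure_measurable_subprob_algebra2)
  have "(SIGMA x:space M. Pair x -` D) = D"
    using sets.sets_into_space[OF D] by (auto simp: space_pair_measure)
  then show "(SIGMA x:space M. Pair x -` D) \<in> sets (M \<Otimes>\<^sub>M N)" using D by simp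
qed (rule measurable_prob_algebraD[OF assms(1)])

text \<open>The bind is the joint law \<pi>(dx) K(x, dy): its inner measure is \<open>K x\<close>
  placed on the fibre over \<open>x\<close>.\<close>

lemma emeasure_kernel_product:
  assumes \<pi>: "\<pi> \<in> space (prob_algebra M)" and K[measurable]: "K \<in> M \<rightarrow>\<^sub>M prob_algebra M"
    and D[measurable]: "D \<in> sets (M \<Otimes>\<^sub>M M)"
  shows "emeasure (\<pi> \<bind> (\<lambda>x. distr (K x) (M \<Otimes>\<^sub>M M) (Pair x))) D = (\<integral>\<^sup>+x. emeasure (K x) (Pair x -` D) \<partial>\<pi>)"
proof -
  have s: "sets \<pi> = sets M" "space \<pi> = space M" 
    using \<pi> by (auto simp: space_prob_algebra dest: sets_eq_imp_space_eq)
  have "emeasure (\<pi> \<bind> (\<lambda>x. distr (K x) (M \<Otimes>\<^sub>M M) (Pair x))) D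
      = (\<integral>\<^sup>+x. emeasure (distr (K x) (M \<Otimes>\<^sub>M M) (Pair x)) D \<partial>\<pi>)"
    by (rule emeasure_bind_prob_algebra[OF \<pi> _ D]) measurable
  also have "\<dots> = (\<integral>\<^sup>+x. emeasure (K x) (Pair x -` D) \<partial>\<pi>)"
  proof (rule nn_integral_cong)
    fix x assume "x \<in> space \<pi>"
    then have x: "x \<in> space M" by (simp add: s)
    then have "sets (K x) = sets M" "space (K x) = space M"
      using measurable_space[OF K x] by (auto simp: space_prob_algebra dest: sets_eq_imp_space_eq)
    moreover have "Pair x -` D \<subseteq> space M" using sets.sets_into_space[OF D] by (auto simp: space_pair_measure)
    ultimately show "emeasure (distr (K x) (M \<Otimes>\<^sub>M M) (Pair x)) D = emeasure (K x) (Pair x -` D)"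
      using x by (subst emeasure_distr) (auto simp: Int_absorb2 cong: measurable_cong_sets)
  qed
  finally show ?thesis .
qed

text \<open>A Hahn decomposition of the joint laws \<open>\<pi>(dx) R(x, dy)\<close> and \<open>c \<pi>(dx) S(x, dy)\<close>.\<close>

lemma kernel_Hahn_decomposition:
  assumes W: "countable W" "algebra (space M) W" "sets M = sigma_sets (space M) W"
    and \<pi>: "\<pi> \<in> space (prob_algebra M)"
    and R[measurable]: "R \<in> M \<rightarrow>\<^sub>M prob_algebra M" and S[measurable]: "S \<in> M \<rightarrow>\<^sub>M prob_algebra M"
    and c: "(c::ennreal) < \<infinity>"
  obtains B where "B \<in> sets (M \<Otimes>\<^sub>M M)"
    "AE x in \<pi>. \<forall>A\<in>sets M. c * emeasure (S x) (A \<inter> Pair x -` B) \<le> emeasure (R x) (A \<inter> Pair x -` B)"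
    "\<And>D. D \<in> sets (M \<Otimes>\<^sub>M M) \<Longrightarrow> D \<inter> B = {} \<Longrightarrow>
      (\<integral>\<^sup>+x. emeasure (R x) (Pair x -` D) \<partial>\<pi>) \<le> c * (\<integral>\<^sup>+x. emeasure (S x) (Pair x -` D) \<partial>\<pi>)"
proof -
  have s[measurable_cong]: "sets \<pi> = sets M" and sp: "space \<pi> = space M" and "prob_space \<pi>"
    using \<pi> by (auto simp: space_prob_algebra dest: sets_eq_imp_space_eq)
  interpret prob_space \<pi> by fact
  define J where "J K = \<pi> \<bind> (\<lambda>x. distr (K x) (M \<Otimes>\<^sub>M M) (Pair x))" for K :: "'a \<Rightarrow> 'a measure"
  have J: "prob_space (J K)" "sets (J K) = sets (M \<Otimes>\<^sub>M M)" if [measurable]: "K \<in> M \<rightarrow>\<^sub>M prob_algebra M" for K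
    unfolding J_def using \<pi> by (intro prob_space_bind' sets_bind'; measurable)+
  have J_em: "emeasure (J K) D = (\<integral>\<^sup>+x. emeasure (K x) (Pair x -` D) \<partial>\<pi>)"
    if "K \<in> M \<rightarrow>\<^sub>M prob_algebra M" "D \<in> sets (M \<Otimes>\<^sub>M M)" for K D
    unfolding J_def using \<pi> that by (rule emeasure_kernel_product)
  have Kx: "prob_space (K x)" "sets (K x) = sets M" "space (K x) = space M" 
    if "K \<in> M \<rightarrow>\<^sub>M prob_algebra M" "x \<in> space M" for K :: "'a \<Rightarrow> 'a measure" and x
    using measurable_space[OF that] by (auto simp: space_prob_algebra dest: sets_eq_imp_space_eq)
  have "\<exists>Y\<in>sets (J R). (\<forall>X\<in>sets (J R). X \<subseteq> Y \<longrightarrow> scale_measure c (J S) X \<le> J R X)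
      \<and> (\<forall>X\<in>sets (J R). X \<inter> Y = {} \<longrightarrow> J R X \<le> scale_measure c (J S) X)"
  proof (rule finite_unsigned_Hahn_decomposition)
    show "finite_measure (J R)" using J(1)[OF R] by (rule prob_space.finite_measure)
    show "finite_measure (scale_measure c (J S))"
      using prob_space.emeasure_space_1[OF J(1)[OF S]] c
      by (intro finite_measureI) (simp add: space_scale_measure)
    show "sets (scale_measure c (J S)) = sets (J R)" using J(2)[OF R] J(2)[OF S] by simp
  qed
  then obtain B where B[measurable]: "B \<in> sets (M \<Otimes>\<^sub>M M)"
    and B1: "\<And>X. X \<in> sets (M \<Otimes>\<^sub>M M) \<Longrightarrow> X \<subseteq> B \<Longrightarrow> c * J S X \<le> J R X"
    and B2: "\<And>X. X \<in> sets (M \<Otimes>\<^sub>M M) \<Longrightarrow> X \<inter> B = {} \<Longrightarrow> J R X \<le> c * J S X"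
    using J(2)[OF R] J(2)[OF S] by auto
  show thesis
  proof (rule that)
    show "B \<in> sets (M \<Otimes>\<^sub>M M)" by fact
    show "(\<integral>\<^sup>+x. emeasure (R x) (Pair x -` D) \<partial>\<pi>) \<le> c * (\<integral>\<^sup>+x. emeasure (S x) (Pair x -` D) \<partial>\<pi>)"
      if "D \<in> sets (M \<Otimes>\<^sub>M M)" "D \<inter> B = {}" for D
      using B2[OF that] that(1) R S by (simp add: J_em)
    have "AE x in \<pi>. \<forall>A\<in>W. c * emeasure (S x) (A \<inter> Pair x -` B) \<le> emeasure (R x) (A \<inter> Pair x -` B)"
    proof (subst AE_ball_countable[OF W(1)], intro ballI)
      fix A assume "A \<in> W"
      then have A[measurable]: "A \<in> sets M" using W(3) by auto
      define f where "f x = c * emeasure (S x) (A \<inter> Pair x -` B)" for x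
      define g where "g x = emeasure (R x) (A \<inter> Pair x -` B)" for x
      have AB: "(space M \<times> A) \<inter> B \<in> sets (M \<Otimes>\<^sub>M M)" by measurable
      have eq: "A \<inter> Pair x -` B = Pair x -` ((space M \<times> A) \<inter> B)" if "x \<in> space M" for x
        using that by auto
      have m: "(\<lambda>x. emeasure (K x) (A \<inter> Pair x -` B)) \<in> borel_measurable M"
        if [measurable]: "K \<in> M \<rightarrow>\<^sub>M prob_algebra M" for K
      proof -
        have "(\<lambda>x. emeasure (K x) (Pair x -` ((space M \<times> A) \<inter> B))) \<in> borel_measurable M"
          using AB by (rule measurable_emeasure_section[OF that])
        then show ?thesis using eq by (subst measurable_cong) auto
      qed
      have fm[measurable]: "f \<in> borel_measurable M" unfolding f_def
        by (intro borel_measurable_times_ennreal m S) simp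
      have gm[measurable]: "g \<in> borel_measurable M" unfolding g_def by (intro m R)
      \<comment> \<open>The points that violate the inequality for \<open>A\<close>. The set (X
        \<times> A) \<inter> B lies in \<open>B\<close>, so the Hahn inequality compares the
        integrals over \<open>X\<close> in the direction opposite to the violation, and
        \<open>X\<close> must be null.\<close>
      define X where "X = {x \<in> space M. g x < f x}"
      have X[measurable]: "X \<in> sets M" unfolding X_def by measurable
      have int: "(\<integral>\<^sup>+x. f x * indicator X x \<partial>\<pi>) \<le> (\<integral>\<^sup>+x. g x * indicator X x \<partial>\<pi>)"
      proof -
        let ?D = "(X \<times> A) \<inter> B"
        have sec: "emeasure (K x) (Pair x -` ?D) = emeasure (K x) (A \<inter> Pair x -` B) * indicator X x" for K :: "'a \<Rightarrow> 'a measure" and x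
        proof (cases "x \<in> X")
          case True
          then have "Pair x -` ?D = A \<inter> Pair x -` B" by auto
          then show ?thesis using True by simp
        next
          case False
          then have "Pair x -` ?D = {}" by auto
          then show ?thesis using False by simp
        qed
        have D: "?D \<in> sets (M \<Otimes>\<^sub>M M)" by measurable
        then have "c * J S ?D \<le> J R ?D" by (intro B1) auto
        then have "c * (\<integral>\<^sup>+x. emeasure (S x) (A \<inter> Pair x -` B) * indicator X x \<partial>\<pi>) \<le> (\<integral>\<^sup>+x. g x * indicator X x \<partial>\<pi>)"
          unfolding J_em[OF R D] J_em[OF S D] sec g_def .
        also have "c * (\<integral>\<^sup>+x. emeasure (S x) (A \<inter> Pair x -` B) * indicator X x \<partial>\<pi>)
            = (\<integral>\<^sup>+x. f x * indicator X x \<partial>\<pi>)"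
          unfolding f_def using m[OF S] by (subst nn_integral_cmult[symmetric]) (auto simp: mult.assoc)
        finally show ?thesis .
      qed
      have "AE x in \<pi>. f x * indicator X x \<le> g x * indicator X x"
      proof (rule ccontr)
        assume *: "\<not> (AE x in \<pi>. f x * indicator X x \<le> g x * indicator X x)"
        have "(\<integral>\<^sup>+x. g x * indicator X x \<partial>\<pi>) \<le> (\<integral>\<^sup>+x. 1 \<partial>\<pi>)"
          using prob_space.emeasure_le_1[OF Kx(1)[OF R]]
          by (intro nn_integral_mono) (auto simp: g_def indicator_def sp)
        then have fin: "(\<integral>\<^sup>+x. g x * indicator X x \<partial>\<pi>) \<noteq> \<infinity>"
          using emeasure_space_1 by (auto simp: top_unique)
        have "(\<integral>\<^sup>+x. g x * indicator X x \<partial>\<pi>) < (\<integral>\<^sup>+x. f x * indicator X x \<partial>\<pi>)"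
          by (intro nn_integral_less fin *) (auto simp: X_def indicator_def)
        with int show False by simp
      qed
      then show "AE x in \<pi>. c * emeasure (S x) (A \<inter> Pair x -` B) \<le> emeasure (R x) (A \<inter> Pair x -` B)"
        using AE_space
      proof eventually_elim
        case (elim x)
        then show ?case
          by (cases "x \<in> X") (auto simp: X_def sp f_def[symmetric] g_def[symmetric])
      qed
    qed
    then show "AE x in \<pi>. \<forall>A\<in>sets M. c * emeasure (S x) (A \<inter> Pair x -` B) \<le> emeasure (R x) (A \<inter> Pair x -` B)"
      using AE_space
    proof eventually_elim
      case (elim x)
      then have x: "x \<in> space M" by (simp add: sp)
      note KS = Kx[OF S x] and KR = Kx[OF R x]
      \<comment> \<open>For fixed \<open>x\<close>, restriction to the section by a density turns
        the claim into an inequality between two finite measures, known on \<open>W\<close> and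
        hence on all of \<open>sets M\<close>.\<close>
      let ?N1 = "density (S x) (\<lambda>y. c * indicator (Pair x -` B) y)"
      let ?N2 = "density (R x) (indicator (Pair x -` B))"
      have Bx[measurable]: "Pair x -` B \<in> sets M" by measurable
      have e1: "emeasure ?N1 A = c * emeasure (S x) (A \<inter> Pair x -` B)" if "A \<in> sets M" for A
        using that Bx KS(2) by (simp add: emeasure_density mult.assoc nn_integral_cmult_indicator
            flip: indicator_inter_arith) (simp add: Int_commute)
      have e2: "emeasure ?N2 A = emeasure (R x) (A \<inter> Pair x -` B)" if "A \<in> sets M" for A
        using that Bx KR(2) by (simp add: emeasure_density 
            flip: indicator_inter_arith) (simp add: Int_commute)
      have "emeasure ?N1 A \<le> emeasure ?N2 A" if A: "A \<in> sets M" for A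
      proof (rule emeasure_le_of_algebra)
        show "finite_measure ?N1"
          using e1[OF sets.top] KS(3) c le_less_trans[OF prob_space.emeasure_le_1[OF KS(1)] ennreal_one_less_top]
          by (intro finite_measureI) (auto simp: ennreal_mult_eq_top_iff less_top[symmetric])
        show "finite_measure ?N2"
          using e2[OF sets.top] KR(3) le_less_trans[OF prob_space.emeasure_le_1[OF KR(1)] ennreal_one_less_top]
          by (intro finite_measureI) (auto simp: less_top[symmetric])
        show "sets ?N1 = sigma_sets (space M) W" "sets ?N2 = sigma_sets (space M) W"
          using KS(2) KR(2) W(3) by auto
        show "A \<in> sets ?N1" using A KS(2) by simp
        show "emeasure ?N1 B' \<le> emeasure ?N2 B'" if "B' \<in> W" for B'
          using that elim(1) W(3) by (simp add: e1 e2)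
      qed (fact W)
      then show ?case by (simp add: e1 e2)
    qed
  qed
qed

text \<open>The sections of \<open>E\<close> form a separable set in the measure algebra of \<open>\<pi>\<close>, so almost every
  \<open>x\<close> is a point of positive mass for the pseudometric \<open>\<pi>(E\<^sub>x \<triangle> E\<^sub>y)\<close>.\<close>

lemma AE_section_neighbourhood:
  assumes W: "countable W" "algebra (space M) W" "sets M = sigma_sets (space M) W"
    and "prob_space \<pi>" and s[measurable_cong]: "sets \<pi> = sets M"
    and E[measurable]: "E \<in> sets (M \<Otimes>\<^sub>M M)"
  shows "AE x in \<pi>. \<forall>e>0. \<exists>A\<in>sets M. x \<in> A \<and> emeasure \<pi> A > 0 \<and>
    (\<forall>y\<in>A. measure \<pi> (sym_diff (Pair x -` E) (Pair y -` E)) < e)"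
proof -
  interpret prob_space \<pi> by fact
  have sp: "space \<pi> = space M" using s by (rule sets_eq_imp_space_eq)
  \<comment> \<open>Balls of radius 1/(k+1) for the pseudometric, centred at the countably many sets
    \<open>U\<close> of \<open>W\<close>. The null ones among them have a null union, so almost
    every \<open>x\<close> lies only in balls of positive mass.\<close>
  define A where "A U k = {x \<in> space M. measure \<pi> (sym_diff (Pair x -` E) U) < 1 / real (Suc k)}" for U k
  have A[measurable]: "A U k \<in> sets M" if "U \<in> W" for U k
  proof -
    have [measurable]: "U \<in> sets M" using that W(3) by auto
    have D: "sym_diff E (space M \<times> U) \<in> sets (M \<Otimes>\<^sub>M \<pi>)"
      by measurable
    have "(\<lambda>x. measure \<pi> (Pair x -` sym_diff E (space M \<times> U))) \<in> borel_measurable M"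
      unfolding measure_def using measurable_emeasure_Pair[OF D] by measurable
    moreover have "Pair x -` sym_diff E (space M \<times> U) = sym_diff (Pair x -` E) U" if "x \<in> space M" for x
      using that by auto
    ultimately have [measurable]: "(\<lambda>x. measure \<pi> (sym_diff (Pair x -` E) U)) \<in> borel_measurable M"
      by (subst measurable_cong) auto
    show ?thesis unfolding A_def by measurable
  qed
  have "AE x in \<pi>. x \<in> A U k \<longrightarrow> emeasure \<pi> (A U k) > 0" if "U \<in> W" for U k
  proof (cases "emeasure \<pi> (A U k) = 0")
    case True
    then have "A U k \<in> null_sets \<pi>" using A[OF that] by (simp add: null_sets_def s)
    then have "AE x in \<pi>. x \<notin> A U k" by (rule AE_not_in)
    then show ?thesis by eventually_elim auto
  qed (auto simp: zero_less_iff_neq_zero)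
  then have "AE x in \<pi>. \<forall>U\<in>W. \<forall>k. x \<in> A U k \<longrightarrow> emeasure \<pi> (A U k) > 0"
    by (auto simp: AE_ball_countable[OF W(1)] AE_all_countable)
  then show ?thesis using AE_space
  proof eventually_elim
    case (elim x)
    show ?case
    proof (intro allI impI)
      fix e :: real assume "e > 0"
      \<comment> \<open>Both \<open>x\<close> and any \<open>y\<close> of the ball are within e/2 of
        its centre, which gives \<open>e\<close> by the triangle inequality.\<close>
      then obtain k where k: "1 / real (Suc k) < e / 2"
        using nat_approx_posE[of "e/2"] by auto
      have Ex[measurable]: "Pair y -` E \<in> sets \<pi>" for y unfolding s by measurable
      obtain U where U: "U \<in> W" "measure \<pi> (sym_diff (Pair x -` E) U) < 1 / real (Suc k)"
        using algebra_approximation[OF finite_measure_axioms finite_measure_axioms _ _ W(2), of "Pair x -` E" "1 / real (Suc k)"]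
          Ex[of x] W(3) s by auto
      have [measurable]: "U \<in> sets \<pi>" using U(1) W(3) s by auto
      have "x \<in> A U k" using U elim(2) by (simp add: A_def sp)
      moreover have "emeasure \<pi> (A U k) > 0" using elim(1) U(1) calculation by blast
      moreover have "measure \<pi> (sym_diff (Pair x -` E) (Pair y -` E)) < e" if "y \<in> A U k" for y
      proof -
        have "measure \<pi> (sym_diff (Pair x -` E) (Pair y -` E))
            \<le> measure \<pi> (sym_diff (Pair x -` E) U \<union> sym_diff (Pair y -` E) U)"
          by (intro finite_measure_mono) auto
        also have "\<dots> \<le> measure \<pi> (sym_diff (Pair x -` E) U) + measure \<pi> (sym_diff (Pair y -` E) U)"
          by (intro measure_Un_le) measurable
        finally show ?thesis using U(2) that k by (simp add: A_def)
      qed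
      ultimately show "\<exists>A\<in>sets M. x \<in> A \<and> emeasure \<pi> A > 0 \<and>
          (\<forall>y\<in>A. measure \<pi> (sym_diff (Pair x -` E) (Pair y -` E)) < e)"
        using A[OF U(1)] by blast
    qed
  qed
qed

context positive_chain
begin

text \<open>Irreducibility makes the parts on which some iterate has a density bounded below exhaust
  the product space.\<close>

lemma exists_density_parts:
  assumes W: "countable W" "algebra (space M) W" "sets M = sigma_sets (space M) W"
  obtains B :: "nat \<times> nat \<Rightarrow> ('a \<times> 'a) set" where "\<And>i. B i \<in> sets (M \<Otimes>\<^sub>M M)"
    "\<And>i. AE x in \<pi>. \<forall>A\<in>sets M. ennreal (1 / real (Suc (snd i))) * emeasure \<pi> (A \<inter> Pair x -` B i)
        \<le> emeasure (kernel_power M P (Suc (fst i)) x) (A \<inter> Pair x -` B i)"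
    "AE x in \<pi>. \<exists>i. emeasure \<pi> (Pair x -` B i) > 0"
proof -
  \<comment> \<open>An index (n, k) stands for the iterate \<open>Suc n\<close> and the lower
    density bound 1/(k+1). The successor keeps the number of steps of the later small set
    positive.\<close>
  define c where "c i = ennreal (1 / real (Suc (snd i)))" for i :: "nat \<times> nat"
  have pc[measurable]: "(\<lambda>_. \<pi>) \<in> M \<rightarrow>\<^sub>M prob_algebra M" using prob_algebra_pi by simp
  define Q where "Q i B \<longleftrightarrow> B \<in> sets (M \<Otimes>\<^sub>M M) \<and>
    (AE x in \<pi>. \<forall>A\<in>sets M. c i * emeasure \<pi> (A \<inter> Pair x -` B)
        \<le> emeasure (kernel_power M P (Suc (fst i)) x) (A \<inter> Pair x -` B)) \<and>
    (\<forall>D\<in>sets (M \<Otimes>\<^sub>M M). D \<inter> B = {} \<longrightarrow>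
      (\<integral>\<^sup>+x. emeasure (kernel_power M P (Suc (fst i)) x) (Pair x -` D) \<partial>\<pi>)
        \<le> c i * (\<integral>\<^sup>+x. emeasure \<pi> (Pair x -` D) \<partial>\<pi>))" for i B
  have "\<exists>B. Q i B" for i
  proof (rule kernel_Hahn_decomposition[OF W prob_algebra_pi measurable_kernel_power[of "Suc (fst i)"] pc])
    show "c i < \<infinity>" by (simp add: c_def)
  qed (unfold Q_def, blast)
  then obtain B where B0: "\<And>i. Q i (B i)" by metis
  then have B[measurable]: "\<And>i. B i \<in> sets (M \<Otimes>\<^sub>M M)"
    and B1: "\<And>i. AE x in \<pi>. \<forall>A\<in>sets M. c i * emeasure \<pi> (A \<inter> Pair x -` B i)
        \<le> emeasure (kernel_power M P (Suc (fst i)) x) (A \<inter> Pair x -` B i)"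
    and B2: "\<And>i D. D \<in> sets (M \<Otimes>\<^sub>M M) \<Longrightarrow> D \<inter> B i = {} \<Longrightarrow>
      (\<integral>\<^sup>+x. emeasure (kernel_power M P (Suc (fst i)) x) (Pair x -` D) \<partial>\<pi>)
        \<le> c i * (\<integral>\<^sup>+x. emeasure \<pi> (Pair x -` D) \<partial>\<pi>)"
    unfolding Q_def by (blast, blast, blast)
  \<comment> \<open>What all parts leave over. As \<open>D\<close> misses B (n, k) for every k, the
    integral of P^(n+1)(x, D_x) is at most 1/(k+1) for every k, hence zero. If \<pi>(D_x) were
    positive, irreducibility would make these probabilities positive for large n.\<close>
  define D where "D = space (M \<Otimes>\<^sub>M M) - (\<Union>i. B i)"
  have D[measurable]: "D \<in> sets (M \<Otimes>\<^sub>M M)" unfolding D_def by measurable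
  have Dx: "Pair x -` D \<in> sets M" for x by measurable
  have "AE x in \<pi>. emeasure (kernel_power M P (Suc n) x) (Pair x -` D) = 0" for n
  proof -
    let ?I = "\<integral>\<^sup>+x. emeasure (kernel_power M P (Suc n) x) (Pair x -` D) \<partial>\<pi>"
    have "?I \<le> ennreal (1 / real (Suc k))" for k
    proof -
      have "?I \<le> c (n, k) * (\<integral>\<^sup>+x. emeasure \<pi> (Pair x -` D) \<partial>\<pi>)"
        using B2[OF D, of "(n, k)"] by (auto simp: D_def simp del: kernel_power.simps)
      also have "\<dots> \<le> c (n, k) * (\<integral>\<^sup>+x. 1 \<partial>\<pi>)"
        using pi.emeasure_le_1 by (intro mult_left_mono nn_integral_mono) auto
      finally show ?thesis by (simp add: c_def pi.emeasure_space_1 del: kernel_power.simps)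
    qed
    moreover have "(\<lambda>k. ennreal (1 / real (Suc k))) \<longlonglongrightarrow> ennreal 0"
      by (intro tendsto_ennrealI LIMSEQ_Suc lim_1_over_n)
    ultimately have "?I \<le> ennreal 0"
      by (intro LIMSEQ_le_const) auto
    then have "?I = 0" by simp
    moreover have "(\<lambda>x. emeasure (kernel_power M P (Suc n) x) (Pair x -` D)) \<in> borel_measurable M"
      by (rule measurable_emeasure_section[OF measurable_kernel_power D])
    ultimately show ?thesis by (subst (asm) nn_integral_0_iff_AE) (auto cong: measurable_cong_sets simp: sets_pi)
  qed
  then have "AE x in \<pi>. \<forall>n. emeasure (kernel_power M P (Suc n) x) (Pair x -` D) = 0"
    by (simp add: AE_all_countable del: kernel_power.simps)
  then have "AE x in \<pi>. emeasure \<pi> (Pair x -` D) = 0"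
    using AE_space
  proof eventually_elim
    case (elim x)
    show ?case
    proof (rule ccontr)
      assume "emeasure \<pi> (Pair x -` D) \<noteq> 0"
      then have "\<forall>\<^sub>F n in sequentially. emeasure (kernel_power M P n x) (Pair x -` D) > 0"
        using elim Dx by (intro eventually_visits) (auto simp: space_pi zero_less_iff_neq_zero)
      then obtain N where "\<And>n. n \<ge> N \<Longrightarrow> emeasure (kernel_power M P n x) (Pair x -` D) > 0"
        by (auto simp: eventually_sequentially)
      from this[of "Suc N"] elim(1) show False by (auto simp del: kernel_power.simps)
    qed
  qed
  then have "AE x in \<pi>. \<exists>i. emeasure \<pi> (Pair x -` B i) > 0"
    using AE_space
  proof eventually_elim
    case (elim x)
    show ?case
    proof (rule ccontr)
      assume "\<not> ?thesis"
      then have 0: "emeasure \<pi> (Pair x -` B i) = 0" for i using zero_less_iff_neq_zero by blast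
      have Bx: "Pair x -` B i \<in> sets \<pi>" for i unfolding sets_pi by measurable
      have "emeasure \<pi> (\<Union>i. Pair x -` B i) = 0"
        using 0 Bx null_sets_UN'[of UNIV "\<lambda>i. Pair x -` B i" \<pi>] by (simp add: null_sets_def)
      moreover have "space M \<subseteq> Pair x -` D \<union> (\<Union>i. Pair x -` B i)"
        using elim by (auto simp: D_def space_pair_measure space_pi)
      then have "emeasure \<pi> (space \<pi>) \<le> emeasure \<pi> (Pair x -` D \<union> (\<Union>i. Pair x -` B i))"
        unfolding space_pi using Bx Dx by (intro emeasure_mono) (auto simp: sets_pi)
      moreover have "\<dots> \<le> emeasure \<pi> (Pair x -` D) + emeasure \<pi> (\<Union>i. Pair x -` B i)"
        using Bx Dx by (intro emeasure_subadditive) (auto simp: sets_pi)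
      ultimately show False using elim pi.emeasure_space_1 by simp
    qed
  qed
  from that[OF B B1[unfolded c_def] this] show thesis .
qed

text \<open>The double integral is the mass of triples with (x, y) in \<open>B i\<close> and (y, z)
  in \<open>B j\<close>, which by Fubini is the integral over y of \<open>f i y * g j y\<close>. If
  it vanished for all i, j, then, as almost every y has some \<open>g j y > 0\<close>, every
  \<open>f i\<close> would vanish almost everywhere. Then all parts would be null in the product,
  against the hypothesis on their sections.\<close>

lemma exists_linked_parts:
  fixes B :: "nat \<times> nat \<Rightarrow> ('a \<times> 'a) set"
  assumes B[measurable]: "\<And>i. B i \<in> sets (M \<Otimes>\<^sub>M M)"
    and ex: "AE x in \<pi>. \<exists>i. emeasure \<pi> (Pair x -` B i) > 0"
  obtains i j where "(\<integral>\<^sup>+x. \<integral>\<^sup>+z. emeasure \<pi> (Pair x -` B i \<inter> (\<lambda>y. (y, z)) -` B j) \<partial>\<pi> \<partial>\<pi>) \<noteq> 0"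
proof -
  interpret pp: pair_sigma_finite \<pi> \<pi> ..
  define f where "f i y = emeasure \<pi> ((\<lambda>x. (x, y)) -` B i)" for i y
  define g where "g i x = emeasure \<pi> (Pair x -` B i)" for i x
  have B\<pi>: "B i \<in> sets (\<pi> \<Otimes>\<^sub>M \<pi>)" for i by measurable
  have [measurable]: "f i \<in> borel_measurable \<pi>" "g i \<in> borel_measurable \<pi>" for i
    unfolding f_def g_def using pp.measurable_emeasure_Pair2[OF B\<pi>] pi.measurable_emeasure_Pair[OF B\<pi>] by auto
  have fg: "(\<integral>\<^sup>+y. f i y \<partial>\<pi>) = (\<integral>\<^sup>+x. g i x \<partial>\<pi>)" for i
    unfolding f_def g_def
    using pp.emeasure_pair_measure_alt2[OF B\<pi>] pi.emeasure_pair_measure_alt[OF B\<pi>] by simp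
  have "\<exists>i j. (\<integral>\<^sup>+y. f i y * g j y \<partial>\<pi>) \<noteq> 0"
  proof (rule ccontr)
    assume "\<not> ?thesis"
    then have "(\<integral>\<^sup>+y. f i y * g j y \<partial>\<pi>) = 0" for i j by blast
    then have "AE y in \<pi>. f i y * g j y = 0" for i j
      by (subst (asm) nn_integral_0_iff_AE) auto
    then have "AE y in \<pi>. \<forall>i j. f i y * g j y = 0"
      unfolding AE_all_countable by blast
    then have "AE y in \<pi>. \<forall>i. f i y = 0"
      using ex by eventually_elim (auto simp: g_def[symmetric] zero_less_iff_neq_zero)
    then have "AE y in \<pi>. f i y = 0" for i by eventually_elim blast
    then have "(\<integral>\<^sup>+y. f i y \<partial>\<pi>) = 0" for i
      by (subst nn_integral_0_iff_AE) auto
    then have "(\<integral>\<^sup>+x. g i x \<partial>\<pi>) = 0" for i unfolding fg .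
    then have "AE x in \<pi>. g i x = 0" for i
      by (subst (asm) nn_integral_0_iff_AE) auto
    then have "AE x in \<pi>. \<forall>i. g i x = 0" unfolding AE_all_countable by blast
    with ex have "AE x in \<pi>. False" by eventually_elim (auto simp: g_def[symmetric])
    then show False by simp
  qed
  then obtain i j where ij: "(\<integral>\<^sup>+y. f i y * g j y \<partial>\<pi>) \<noteq> 0" by blast
  define F where "F x y z = (indicator (B i) (x, y) * indicator (B j) (y, z) :: ennreal)" for x y z
  have Bi: "(\<lambda>x. (x, y)) -` B i \<in> sets \<pi>" "Pair y -` B i \<in> sets \<pi>" for i y
    unfolding sets_pi by (rule sets_Pair2[OF B] sets_Pair1[OF B])+
  have "f i y * g j y = (\<integral>\<^sup>+x. \<integral>\<^sup>+z. F x y z \<partial>\<pi> \<partial>\<pi>)" for y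
  proof -
    have "(\<integral>\<^sup>+x. \<integral>\<^sup>+z. F x y z \<partial>\<pi> \<partial>\<pi>)
      = (\<integral>\<^sup>+x. \<integral>\<^sup>+z. indicator ((\<lambda>x. (x, y)) -` B i) x * indicator (Pair y -` B j) z \<partial>\<pi> \<partial>\<pi>)"
      by (simp add: F_def indicator_def)
    also have "\<dots> = (\<integral>\<^sup>+x. indicator ((\<lambda>x. (x, y)) -` B i) x * g j y \<partial>\<pi>)"
      using Bi by (subst nn_integral_cmult_indicator) (auto simp: g_def)
    also have "\<dots> = f i y * g j y"
      using Bi by (subst nn_integral_multc) (auto simp: f_def)
    finally show ?thesis by simp
  qed
  then have "(\<integral>\<^sup>+y. f i y * g j y \<partial>\<pi>) = (\<integral>\<^sup>+y. \<integral>\<^sup>+x. \<integral>\<^sup>+z. F x y z \<partial>\<pi> \<partial>\<pi> \<partial>\<pi>)" by simp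
  also have "\<dots> = (\<integral>\<^sup>+x. \<integral>\<^sup>+y. \<integral>\<^sup>+z. F x y z \<partial>\<pi> \<partial>\<pi> \<partial>\<pi>)"
    unfolding F_def by (intro pp.Fubini') measurable
  also have "\<dots> = (\<integral>\<^sup>+x. \<integral>\<^sup>+z. \<integral>\<^sup>+y. F x y z \<partial>\<pi> \<partial>\<pi> \<partial>\<pi>)"
    unfolding F_def
    by (intro nn_integral_cong pp.Fubini'[symmetric]) (simp add: space_pi, measurable)
  also have "\<dots> = (\<integral>\<^sup>+x. \<integral>\<^sup>+z. emeasure \<pi> (Pair x -` B i \<inter> (\<lambda>y. (y, z)) -` B j) \<partial>\<pi> \<partial>\<pi>)"
  proof (intro nn_integral_cong)
    fix x z
    have "(\<integral>\<^sup>+y. F x y z \<partial>\<pi>) = (\<integral>\<^sup>+y. indicator (Pair x -` B i \<inter> (\<lambda>y. (y, z)) -` B j) y \<partial>\<pi>)"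
      by (intro nn_integral_cong) (auto simp: F_def indicator_def)
    then show "(\<integral>\<^sup>+y. F x y z \<partial>\<pi>) = emeasure \<pi> (Pair x -` B i \<inter> (\<lambda>y. (y, z)) -` B j)"
      using Bi by simp
  qed
  finally show thesis using ij that by simp
qed

text \<open>The chain moves x -> y -> z with both moves in parts of density bounded below, so the (n
  + n')-step density at (x, z) is at least c d \<pi>(B_x \<inter> B'_z). Near a pair (x0, z0) where
  the last factor is positive it stays above some \<open>e\<close>; \<nu> is \<pi> conditioned on
  the neighbourhood \<open>Z\<close> of z0.\<close>

lemma exists_small_set:
  assumes "countably_generated_space M"
  obtains C m \<nu> \<delta> where "C \<in> sets M" "emeasure \<pi> C > 0" "0 < m" "\<nu> \<in> space (prob_algebra M)"
    "0 < \<delta>" "\<delta> < 1"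
    "\<And>x A. x \<in> C \<Longrightarrow> A \<in> sets M \<Longrightarrow> ennreal \<delta> * emeasure \<nu> A \<le> emeasure (kernel_power M P m x) A"
proof -
  interpret pp: pair_sigma_finite \<pi> \<pi> ..
  obtain G where G: "countable G" "G \<subseteq> Pow (space M)" "sets M = sigma_sets (space M) G"
    using assms by (auto simp: countably_generated_space_def)
  obtain W where W: "countable W" "algebra (space M) W" "sets M = sigma_sets (space M) W"
    using countable_generating_algebra[OF G(1,2)] G(3) by metis
  obtain B where B[measurable]: "\<And>i. B i \<in> sets (M \<Otimes>\<^sub>M M)"
    and B1: "\<And>i. AE x in \<pi>. \<forall>A\<in>sets M. ennreal (1 / real (Suc (snd i))) * emeasure \<pi> (A \<inter> Pair x -` B i)
        \<le> emeasure (kernel_power M P (Suc (fst i)) x) (A \<inter> Pair x -` B i)"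
    and B2: "AE x in \<pi>. \<exists>i. emeasure \<pi> (Pair x -` B i) > 0"
    by (rule exists_density_parts[OF W]) (rule that)
  obtain i j where ij: "(\<integral>\<^sup>+x. \<integral>\<^sup>+z. emeasure \<pi> (Pair x -` B i \<inter> (\<lambda>y. (y, z)) -` B j) \<partial>\<pi> \<partial>\<pi>) \<noteq> 0"
    by (rule exists_linked_parts[OF B B2]) (rule that)
  \<comment> \<open>The coordinates of \<open>B j\<close> are swapped so that its sections at fixed
    endpoint z become first-coordinate sections, to which \<open>AE_section_neighbourhood\<close>
    applies.\<close>
  define B' where "B' = (\<lambda>(z, y). (y, z)) -` B j \<inter> space (M \<Otimes>\<^sub>M M)"
  have B'[measurable]: "B' \<in> sets (M \<Otimes>\<^sub>M M)" unfolding B'_def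
    by (rule measurable_sets[OF measurable_pair_swap' B])
  have B'_sec: "Pair z -` B' = (\<lambda>y. (y, z)) -` B j" if "z \<in> space M" for z
    using that sets.sets_into_space[OF B, of j] by (auto simp: B'_def space_pair_measure)
  have Bx[measurable]: "Pair x -` B k \<in> sets \<pi>" "Pair x -` B' \<in> sets \<pi>" for x k
    unfolding sets_pi by (rule sets_Pair1[OF B] sets_Pair1[OF B'])+
  define c where "c = 1 / real (Suc (snd i))"
  define d where "d = 1 / real (Suc (snd j))"
  define n where "n = Suc (fst i)"
  define n' where "n' = Suc (fst j)"
  have cd: "c > 0" "d > 0" by (auto simp: c_def d_def)
  let ?phi = "\<lambda>x z. emeasure \<pi> (Pair x -` B i \<inter> Pair z -` B')"
  let ?nb = "\<lambda>E x. \<forall>e>0. \<exists>A\<in>sets M. x \<in> A \<and> emeasure \<pi> A > 0 \<and>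
    (\<forall>y\<in>A. measure \<pi> (sym_diff (Pair x -` E) (Pair y -` E)) < e)"
  note nb = AE_section_neighbourhood[OF W pi.prob_space_axioms sets_pi]
  have "(\<integral>\<^sup>+x. \<integral>\<^sup>+z. ?phi x z \<partial>\<pi> \<partial>\<pi>) = (\<integral>\<^sup>+x. \<integral>\<^sup>+z. emeasure \<pi> (Pair x -` B i \<inter> (\<lambda>y. (y, z)) -` B j) \<partial>\<pi> \<partial>\<pi>)"
    by (intro nn_integral_cong) (simp add: B'_sec space_pi)
  then have "\<not> (AE x in \<pi>. (\<integral>\<^sup>+z. ?phi x z \<partial>\<pi>) = 0)"
    using ij nn_integral_cong_AE[of "\<lambda>x. \<integral>\<^sup>+z. ?phi x z \<partial>\<pi>" "\<lambda>_. 0" \<pi>] by auto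
  then obtain x0 where x0: "?nb (B i) x0" "(\<integral>\<^sup>+z. ?phi x0 z \<partial>\<pi>) \<noteq> 0"
    using eventually_mono[OF nb[OF B[of i]], of "\<lambda>x. (\<integral>\<^sup>+z. ?phi x z \<partial>\<pi>) = 0"] by blast
  then have "\<not> (AE z in \<pi>. ?phi x0 z = 0)"
    using nn_integral_cong_AE[of "\<lambda>z. ?phi x0 z" "\<lambda>_. 0" \<pi>] by auto
  then obtain z0 where z0: "?nb B' z0" "?phi x0 z0 \<noteq> 0"
    using eventually_mono[OF nb[OF B'], of "\<lambda>z. ?phi x0 z = 0"] by blast
  \<comment> \<open>A third of the mass at (x0, z0): moving x and moving z lose less than
    \<open>e\<close> each, which leaves at least \<open>e\<close>.\<close>
  define e where "e = measure \<pi> (Pair x0 -` B i \<inter> Pair z0 -` B') / 3"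
  have "measure \<pi> (Pair x0 -` B i \<inter> Pair z0 -` B') \<noteq> 0"
    using z0(2) pi.emeasure_eq_measure[of "Pair x0 -` B i \<inter> Pair z0 -` B'"] by auto
  then have e: "e > 0" by (simp add: e_def zero_less_measure_iff)
  obtain A where A: "A \<in> sets M" "emeasure \<pi> A > 0"
    "\<And>x. x \<in> A \<Longrightarrow> measure \<pi> (sym_diff (Pair x0 -` B i) (Pair x -` B i)) < e"
    using x0(1) e by blast
  obtain Z where Z[measurable]: "Z \<in> sets M" and Z': "emeasure \<pi> Z > 0"
    "\<And>z. z \<in> Z \<Longrightarrow> measure \<pi> (sym_diff (Pair z0 -` B') (Pair z -` B')) < e"
    using z0(1) e by blast
  have phi: "ennreal e \<le> ?phi x z" if "x \<in> A" "z \<in> Z" for x z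
  proof -
    have "measure \<pi> (Pair x0 -` B i \<inter> Pair z0 -` B') \<le> measure \<pi> ((Pair x -` B i \<inter> Pair z -` B')
        \<union> (sym_diff (Pair x0 -` B i) (Pair x -` B i) \<union> sym_diff (Pair z0 -` B') (Pair z -` B')))"
      by (intro pi.finite_measure_mono) (auto intro!: sets.Un sets.Diff sets.Int Bx)
    also have "\<dots> \<le> measure \<pi> (Pair x -` B i \<inter> Pair z -` B') +
        measure \<pi> (sym_diff (Pair x0 -` B i) (Pair x -` B i) \<union> sym_diff (Pair z0 -` B') (Pair z -` B'))"
      by (intro measure_Un_le sets.Un sets.Diff sets.Int Bx)
    also have "measure \<pi> (sym_diff (Pair x0 -` B i) (Pair x -` B i) \<union> sym_diff (Pair z0 -` B') (Pair z -` B'))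
      \<le> measure \<pi> (sym_diff (Pair x0 -` B i) (Pair x -` B i)) + measure \<pi> (sym_diff (Pair z0 -` B') (Pair z -` B'))"
      by (intro measure_Un_le sets.Un sets.Diff sets.Int Bx)
    also have "\<dots> \<le> e + e" using A(3)[OF that(1)] Z'(2)[OF that(2)] by simp
    finally have "e \<le> measure \<pi> (Pair x -` B i \<inter> Pair z -` B')" by (simp add: e_def)
    then show ?thesis by (simp add: pi.emeasure_eq_measure ennreal_leI)
  qed
  obtain N where N: "N \<in> null_sets \<pi>" "\<And>x A. x \<in> space M - N \<Longrightarrow> A \<in> sets M \<Longrightarrow>
      ennreal c * emeasure \<pi> (A \<inter> Pair x -` B i) \<le> emeasure (kernel_power M P n x) (A \<inter> Pair x -` B i)"
    using AE_E3[OF B1[of i]] unfolding c_def n_def space_pi by metis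
  \<comment> \<open>The bound for the first move holds only outside the null set \<open>N\<close>.
    Removing it makes the minorization valid at every point of \<open>C\<close> without loss of
    mass.\<close>
  define C where "C = A - N"
  have C: "C \<in> sets M" using A(1) N(1) by (auto simp: C_def sets_pi null_sets_def)
  have "emeasure \<pi> C > 0"
    using A N(1) unfolding C_def by (simp add: emeasure_Diff_null_set sets_pi)
  define \<nu> where "\<nu> = uniform_measure \<pi> Z"
  have Z0: "emeasure \<pi> Z \<noteq> 0" "emeasure \<pi> Z \<noteq> \<infinity>" using Z' pi.emeasure_finite by auto
  have "\<nu> \<in> space (prob_algebra M)"
    unfolding space_prob_algebra \<nu>_def using Z0 by (auto simp: sets_pi intro!: prob_space_uniform_measure)
  \<comment> \<open>The factor \<open>measure \<pi> Z\<close> undoes the normalisation of \<nu>; the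
    minimum with 1/2 secures \<delta> < 1.\<close>
  define \<delta> where "\<delta> = min (c * d * e * measure \<pi> Z) (1/2)"
  have mZ: "measure \<pi> Z > 0" using Z' by (simp add: pi.emeasure_eq_measure)
  have lower: "ennreal (c * d * e) * emeasure \<pi> (Z \<inter> D) \<le> emeasure (kernel_power M P (n + n') x) D"
    if x: "x \<in> C" and D[measurable]: "D \<in> sets M" for x D
  proof -
    have xM: "x \<in> space M" using x C sets.sets_into_space by blast
    have xA: "x \<in> A" using x by (simp add: C_def)
    define h where "h = expect n' (indicator D)"
    have h[measurable]: "h \<in> borel_measurable M" unfolding h_def by measurable
    let ?Bx = "Pair x -` B i"
    have BxM[measurable]: "?Bx \<in> sets M" using Bx(1) by (simp add: sets_pi)
    let ?K = "kernel_power M P n x"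
    have sK[measurable_cong]: "sets ?K = sets M" by (rule sets_kernel_power[OF xM])
    have le: "density \<pi> (\<lambda>y. ennreal c * indicator ?Bx y) \<le> ?K"
    proof (rule le_measure[THEN iffD2, OF _ ballI])
      show "sets (density \<pi> (\<lambda>y. ennreal c * indicator ?Bx y)) = sets ?K" by (simp add: sK sets_pi)
      fix E assume "E \<in> sets (density \<pi> (\<lambda>y. ennreal c * indicator ?Bx y))"
      then have E[measurable]: "E \<in> sets M" by (simp add: sets_pi)
      have "emeasure (density \<pi> (\<lambda>y. ennreal c * indicator ?Bx y)) E
          = (\<integral>\<^sup>+y. ennreal c * indicator ?Bx y * indicator E y \<partial>\<pi>)"
        by (rule emeasure_density) measurable
      also have "\<dots> = (\<integral>\<^sup>+y. ennreal c * indicator (E \<inter> ?Bx) y \<partial>\<pi>)"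
        by (intro nn_integral_cong) (auto simp: indicator_def)
      also have "\<dots> = ennreal c * emeasure \<pi> (E \<inter> ?Bx)"
        by (subst nn_integral_cmult_indicator) measurable
      also have "\<dots> \<le> emeasure ?K (E \<inter> ?Bx)" using N(2)[of x E] x xM by (simp add: C_def)
      also have "\<dots> \<le> emeasure ?K E" by (intro emeasure_mono) auto
      finally show "emeasure (density \<pi> (\<lambda>y. ennreal c * indicator ?Bx y)) E \<le> emeasure ?K E" .
    qed
    have "(\<integral>\<^sup>+y. ennreal c * indicator ?Bx y * h y \<partial>\<pi>) = (\<integral>\<^sup>+y. h y \<partial>density \<pi> (\<lambda>y. ennreal c * indicator ?Bx y))"
      by (subst nn_integral_density) auto
    also have "\<dots> \<le> (\<integral>\<^sup>+y. h y \<partial>?K)"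
      by (rule nn_integral_mono_measure[OF _ le]) (simp add: sK sets_pi)
    also have "\<dots> = expect n (expect n' (indicator D)) x" by (simp add: expect_def h_def)
    also have "\<dots> = emeasure (kernel_power M P (n + n') x) D"
      using xM by (simp add: expect_expect expect_indicator)
    finally have 1: "(\<integral>\<^sup>+y. ennreal c * indicator ?Bx y * h y \<partial>\<pi>) \<le> emeasure (kernel_power M P (n + n') x) D" .
    \<comment> \<open>For the second move an almost everywhere bound suffices, because the law of
      the first move has already been bounded below by a density with respect to \<pi>.\<close>
    have "AE y in \<pi>. ennreal d * emeasure \<pi> (D \<inter> Pair y -` B j) \<le> h y"
      using B1[of j] AE_space
    proof eventually_elim
      case (elim y)
      then have y: "y \<in> space M" by (simp add: space_pi)
      have "ennreal d * emeasure \<pi> (D \<inter> Pair y -` B j) \<le> emeasure (kernel_power M P n' y) (D \<inter> Pair y -` B j)"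
        using elim(1) D unfolding d_def n'_def by blast
      also have "\<dots> \<le> emeasure (kernel_power M P n' y) D"
        using y by (intro emeasure_mono) (auto simp: sets_kernel_power)
      finally show ?case using y by (simp add: h_def expect_indicator)
    qed
    then have "(\<integral>\<^sup>+y. ennreal c * indicator ?Bx y * (ennreal d * emeasure \<pi> (D \<inter> Pair y -` B j)) \<partial>\<pi>)
        \<le> (\<integral>\<^sup>+y. ennreal c * indicator ?Bx y * h y \<partial>\<pi>)"
      by (intro nn_integral_mono_AE, eventually_elim) (auto intro: mult_left_mono)
    also note 1
    also have "(\<integral>\<^sup>+y. ennreal c * indicator ?Bx y * (ennreal d * emeasure \<pi> (D \<inter> Pair y -` B j)) \<partial>\<pi>)
      = (\<integral>\<^sup>+y. \<integral>\<^sup>+z. ennreal (c * d) * (indicator ?Bx y * (indicator D z * indicator (B j) (y, z))) \<partial>\<pi> \<partial>\<pi>)"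
    proof (intro nn_integral_cong)
      fix y
      have "(\<integral>\<^sup>+z. ennreal (c * d) * (indicator ?Bx y * (indicator D z * indicator (B j) (y, z))) \<partial>\<pi>)
        = (\<integral>\<^sup>+z. (ennreal (c * d) * indicator ?Bx y) * indicator (D \<inter> Pair y -` B j) z \<partial>\<pi>)"
        by (intro nn_integral_cong) (auto simp: indicator_def)
      also have "\<dots> = (ennreal (c * d) * indicator ?Bx y) * emeasure \<pi> (D \<inter> Pair y -` B j)"
        using Bx D by (subst nn_integral_cmult_indicator) (auto simp: sets_pi)
      finally show "ennreal c * indicator ?Bx y * (ennreal d * emeasure \<pi> (D \<inter> Pair y -` B j))
        = (\<integral>\<^sup>+z. ennreal (c * d) * (indicator ?Bx y * (indicator D z * indicator (B j) (y, z))) \<partial>\<pi>)"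
        using cd by (simp add: ennreal_mult ac_simps)
    qed
    also have "\<dots> = (\<integral>\<^sup>+z. \<integral>\<^sup>+y. ennreal (c * d) * (indicator ?Bx y * (indicator D z * indicator (B j) (y, z))) \<partial>\<pi> \<partial>\<pi>)"
      by (intro pp.Fubini'[symmetric]) measurable
    finally have 2: "(\<integral>\<^sup>+z. \<integral>\<^sup>+y. ennreal (c * d) * (indicator ?Bx y * (indicator D z * indicator (B j) (y, z))) \<partial>\<pi> \<partial>\<pi>)
        \<le> emeasure (kernel_power M P (n + n') x) D" .
    have "(\<integral>\<^sup>+z. ennreal (c * d * e) * indicator (Z \<inter> D) z \<partial>\<pi>)
        \<le> (\<integral>\<^sup>+z. \<integral>\<^sup>+y. ennreal (c * d) * (indicator ?Bx y * (indicator D z * indicator (B j) (y, z))) \<partial>\<pi> \<partial>\<pi>)"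
    proof (intro nn_integral_mono)
      fix z assume "z \<in> space \<pi>"
      then have z: "z \<in> space M" by (simp add: space_pi)
      have "(\<integral>\<^sup>+y. ennreal (c * d) * (indicator ?Bx y * (indicator D z * indicator (B j) (y, z))) \<partial>\<pi>)
        = (\<integral>\<^sup>+y. ennreal (c * d) * indicator D z * indicator (?Bx \<inter> Pair z -` B') y \<partial>\<pi>)"
        unfolding B'_sec[OF z] by (intro nn_integral_cong) (auto simp: indicator_def)
      also have "\<dots> = ennreal (c * d) * indicator D z * ?phi x z"
        using Bx by (subst nn_integral_cmult_indicator) auto
      finally show "ennreal (c * d * e) * indicator (Z \<inter> D) z \<le>
          (\<integral>\<^sup>+y. ennreal (c * d) * (indicator ?Bx y * (indicator D z * indicator (B j) (y, z))) \<partial>\<pi>)"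
        using phi[OF xA, of z] cd e by (auto simp: indicator_def ennreal_mult intro!: mult_left_mono)
    qed
    also note 2
    also have "(\<integral>\<^sup>+z. ennreal (c * d * e) * indicator (Z \<inter> D) z \<partial>\<pi>) = ennreal (c * d * e) * emeasure \<pi> (Z \<inter> D)"
      by (subst nn_integral_cmult_indicator) measurable
    finally show ?thesis .
  qed
  show thesis
  proof (rule that[of C "n + n'" \<nu> \<delta>])
    show "C \<in> sets M" "emeasure \<pi> C > 0" "\<nu> \<in> space (prob_algebra M)" by fact+
    show "0 < n + n'" by (simp add: n_def)
    show "0 < \<delta>" "\<delta> < 1" using cd e mZ by (auto simp: \<delta>_def)
    show "ennreal \<delta> * emeasure \<nu> D \<le> emeasure (kernel_power M P (n + n') x) D"
      if "x \<in> C" "D \<in> sets M" for x D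
    proof -
      have \<nu>D: "emeasure \<nu> D = emeasure \<pi> (Z \<inter> D) / emeasure \<pi> Z"
        unfolding \<nu>_def using that(2) by (subst emeasure_uniform_measure) (auto simp: sets_pi)
      have "ennreal \<delta> * emeasure \<nu> D \<le> ennreal (c * d * e * measure \<pi> Z) * emeasure \<nu> D"
        by (intro mult_right_mono ennreal_leI) (auto simp: \<delta>_def)
      also have "\<dots> = ennreal (c * d * e * measure \<pi> Z) * (emeasure \<pi> (Z \<inter> D) / emeasure \<pi> Z)"
        unfolding \<nu>D ..
      also have "\<dots>
          = ennreal (c * d * e) * emeasure \<pi> (Z \<inter> D)"
        using mZ cd e by (simp add: pi.emeasure_eq_measure divide_ennreal flip: ennreal_mult)
      also note lower[OF that]
      finally show ?thesis .
    qed
  qed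
qed

end

subsection \<open>The Markov property of the chain law\<close>

context markov_kernel
begin

text \<open>Computations with the infinite-time law go through its marginals on initial segments,
  which the Ionescu-Tulcea construction gives as finite compositions of
  \<open>chain_step\<close>.\<close>

lemma
  assumes \<mu>: "\<mu> \<in> space (prob_algebra M)"
  shows sets_chain_law: "sets (chain_law M P \<mu>) = sets (PiM UNIV (\<lambda>_. M))"
    and space_chain_law: "space (chain_law M P \<mu>) = space (PiM UNIV (\<lambda>_. M))"
    and distr_chain_law: "distr (chain_law M P \<mu>) (PiM {0..<n} (\<lambda>_. M)) (\<lambda>\<omega>. restrict \<omega> {0..<n})
      = Ionescu_Tulcea.C (chain_step P \<mu>) (\<lambda>_. M) 0 n (\<lambda>_. undefined)"
    and prob_space_chain_law: "prob_space (chain_law M P \<mu>)"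
proof -
  interpret IT: Ionescu_Tulcea "chain_step P \<mu>" "\<lambda>_. M"
    by (rule Ionescu_Tulcea_chain_step[OF kernel \<mu>])
  show sets: "sets (chain_law M P \<mu>) = sets (PiM UNIV (\<lambda>_. M))"
    and "space (chain_law M P \<mu>) = space (PiM UNIV (\<lambda>_. M))"
    unfolding chain_law_def by auto
  show d: "distr (chain_law M P \<mu>) (PiM {0..<n} (\<lambda>_. M)) (\<lambda>\<omega>. restrict \<omega> {0..<n})
      = IT.C 0 n (\<lambda>_. undefined)" for n
  proof -
    have "\<not> IT.up_to {0..<n} < n"
      using IT.up_to_less[of "{0..<n}" "IT.up_to {0..<n}"] by auto
    moreover have "IT.up_to {0..<n} \<le> n" by (simp add: IT.up_to_iff)
    ultimately have "IT.up_to {0..<n} = n" by simp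
    then have "IT.CI {0..<n} = IT.C 0 n (\<lambda>_. undefined)"
      using IT.distr_C[of n n "\<lambda>_. undefined" 0] by (simp add: IT.CI_def space_PiM)
    then show ?thesis using IT.distr_lim[of "{0..<n}"] by (simp add: chain_law_def)
  qed
  \<comment> \<open>A push-forward preserves total mass, so the marginal on the empty index set
    already shows that the mass is 1.\<close>
  have "prob_space (distr (chain_law M P \<mu>) (PiM {0..<0} (\<lambda>_. M)) (\<lambda>\<omega>. restrict \<omega> {0..<0}))"
    unfolding d by (intro IT.prob_space_C) (simp add: space_PiM)
  then show "prob_space (chain_law M P \<mu>)"
    by (rule prob_space_distrD[rotated]) (use sets in \<open>auto cong: measurable_cong_sets intro!: measurable_restrict\<close>)
qed

lemma measurable_restrict_chain_law[measurable]:
  assumes "\<mu> \<in> space (prob_algebra M)"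
  shows "(\<lambda>\<omega>. restrict \<omega> {0..<n}) \<in> chain_law M P \<mu> \<rightarrow>\<^sub>M PiM {0..<n} (\<lambda>_. M)"
  unfolding measurable_cong_sets[OF sets_chain_law[OF assms] refl] by (rule measurable_restrict_subset) simp

lemma measurable_component_chain_law:
  assumes "\<mu> \<in> space (prob_algebra M)"
  shows "(\<lambda>\<omega>. \<omega> n) \<in> chain_law M P \<mu> \<rightarrow>\<^sub>M M"
  unfolding measurable_cong_sets[OF sets_chain_law[OF assms] refl] by (rule measurable_component_singleton) simp

lemma nn_integral_chain_law_step:
  assumes \<mu>: "\<mu> \<in> space (prob_algebra M)" and f[measurable]: "f \<in> borel_measurable (PiM {0..<Suc n} (\<lambda>_. M))"
  shows "(\<integral>\<^sup>+\<omega>. f (restrict \<omega> {0..<Suc n}) \<partial>chain_law M P \<mu>)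
    = (\<integral>\<^sup>+\<omega>. \<integral>\<^sup>+y. f ((restrict \<omega> {0..<n})(n := y)) \<partial>chain_step P \<mu> n (restrict \<omega> {0..<n}) \<partial>chain_law M P \<mu>)"
proof -
  interpret IT: Ionescu_Tulcea "chain_step P \<mu>" "\<lambda>_. M"
    by (rule Ionescu_Tulcea_chain_step[OF kernel \<mu>])
  let ?u = "\<lambda>_::nat. undefined :: 'a"
  have u: "?u \<in> space (PiM {0..<0} (\<lambda>_. M))" by (simp add: space_PiM)
  have sC: "sets (IT.C 0 k ?u) = sets (PiM {0..<k} (\<lambda>_. M))" "space (IT.C 0 k ?u) = space (PiM {0..<k} (\<lambda>_. M))" for k
    using IT.sets_C[OF u, of k] IT.space_C[OF u, of k] by simp_all
  note mr = measurable_restrict_chain_law[OF \<mu>]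
  have "(\<integral>\<^sup>+\<omega>. f (restrict \<omega> {0..<Suc n}) \<partial>chain_law M P \<mu>) = (\<integral>\<^sup>+w. f w \<partial>IT.C 0 (Suc n) ?u)"
    unfolding distr_chain_law[OF \<mu>, symmetric] by (subst nn_integral_distr[OF mr]) (simp_all add: f)
  also have "\<dots> = (\<integral>\<^sup>+w. \<integral>\<^sup>+v. f v \<partial>IT.eP n w \<partial>IT.C 0 n ?u)"
  proof -
    have "IT.eP n \<in> IT.C 0 n ?u \<rightarrow>\<^sub>M subprob_algebra (PiM {0..<Suc n} (\<lambda>_. M))"
      using IT.measurable_eP[of n] by (simp add: measurable_cong_sets[OF sC(1) refl])
    then show ?thesis by (simp add: nn_integral_bind[OF f])
  qed
  also have "\<dots> = (\<integral>\<^sup>+\<omega>. \<integral>\<^sup>+v. f v \<partial>IT.eP n (restrict \<omega> {0..<n}) \<partial>chain_law M P \<mu>)"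
    unfolding distr_chain_law[OF \<mu>, symmetric]
    by (subst nn_integral_distr[OF mr]) measurable
  also have "\<dots> = (\<integral>\<^sup>+\<omega>. \<integral>\<^sup>+y. f ((restrict \<omega> {0..<n})(n := y)) \<partial>chain_step P \<mu> n (restrict \<omega> {0..<n}) \<partial>chain_law M P \<mu>)"
    using measurable_space[OF mr] by (intro nn_integral_cong IT.nn_integral_eP f)
  finally show ?thesis .
qed

lemma nn_integral_chain_law_initial:
  assumes \<mu>: "\<mu> \<in> space (prob_algebra M)" and f[measurable]: "f \<in> borel_measurable M"
  shows "(\<integral>\<^sup>+\<omega>. f (\<omega> 0) \<partial>chain_law M P \<mu>) = (\<integral>\<^sup>+x. f x \<partial>\<mu>)"
proof -
  have "(\<integral>\<^sup>+\<omega>. f (\<omega> 0) \<partial>chain_law M P \<mu>) = (\<integral>\<^sup>+\<omega>. f (restrict \<omega> {0..<Suc 0} 0) \<partial>chain_law M P \<mu>)"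
    by simp
  also have "\<dots> = (\<integral>\<^sup>+\<omega>. \<integral>\<^sup>+y. f (((restrict \<omega> {0..<0})(0 := y)) 0) \<partial>chain_step P \<mu> 0 (restrict \<omega> {0..<0}) \<partial>chain_law M P \<mu>)"
    by (rule nn_integral_chain_law_step[OF \<mu>, of "\<lambda>w. f (w 0)"]) measurable
  also have "\<dots> = (\<integral>\<^sup>+x. f x \<partial>\<mu>)"
    by (simp add: prob_space.emeasure_space_1[OF prob_space_chain_law[OF \<mu>]])
  finally show ?thesis .
qed

lemma markov_property_Suc:
  assumes \<mu>: "\<mu> \<in> space (prob_algebra M)"
    and F[measurable]: "case_prod F \<in> borel_measurable (PiM {0..<Suc n} (\<lambda>_. M) \<Otimes>\<^sub>M M)"
  shows "(\<integral>\<^sup>+\<omega>. F (restrict \<omega> {0..<Suc n}) (\<omega> (Suc n)) \<partial>chain_law M P \<mu>)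
    = (\<integral>\<^sup>+\<omega>. \<integral>\<^sup>+y. F (restrict \<omega> {0..<Suc n}) y \<partial>P (\<omega> n) \<partial>chain_law M P \<mu>)"
proof -
  let ?f = "\<lambda>w. F (restrict w {0..<Suc n}) (w (Suc n))"
  have "?f \<in> borel_measurable (PiM {0..<Suc (Suc n)} (\<lambda>_. M))"
  proof -
    have [measurable]: "(\<lambda>w. restrict w {0..<Suc n}) \<in> PiM {0..<Suc (Suc n)} (\<lambda>_. M) \<rightarrow>\<^sub>M PiM {0..<Suc n} (\<lambda>_. M)"
      by (rule measurable_restrict_subset) simp
    have [measurable]: "(\<lambda>w. w (Suc n)) \<in> PiM {0..<Suc (Suc n)} (\<lambda>_. M) \<rightarrow>\<^sub>M M"
      by (rule measurable_component_singleton) simp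
    show ?thesis by measurable
  qed
  from nn_integral_chain_law_step[OF \<mu> this]
  have "(\<integral>\<^sup>+\<omega>. ?f (restrict \<omega> {0..<Suc (Suc n)}) \<partial>chain_law M P \<mu>)
    = (\<integral>\<^sup>+\<omega>. \<integral>\<^sup>+y. ?f ((restrict \<omega> {0..<Suc n})(Suc n := y)) \<partial>P (\<omega> n) \<partial>chain_law M P \<mu>)"
    by (simp del: restrict_apply) simp
  moreover have "restrict (restrict \<omega> {0..<Suc (Suc n)}) {0..<Suc n} = restrict \<omega> {0..<Suc n}" for \<omega> :: "nat \<Rightarrow> 'a"
    by auto
  moreover have "restrict ((restrict \<omega> {0..<Suc n})(Suc n := y)) {0..<Suc n} = restrict \<omega> {0..<Suc n}" for \<omega> :: "nat \<Rightarrow> 'a" and y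
    by auto
  ultimately show ?thesis by simp
qed

text \<open>\<open>F\<close> may depend on the whole past up to time \<open>n\<close>, as needed for
  events such as "no return so far" and for counts of visits. The induction reads \<open>F\<close>
  as a function of the longer history up to n + m and integrates out the last step.\<close>

lemma markov_property:
  assumes \<mu>: "\<mu> \<in> space (prob_algebra M)"
    and "case_prod F \<in> borel_measurable (PiM {0..<Suc n} (\<lambda>_. M) \<Otimes>\<^sub>M M)"
  shows "(\<integral>\<^sup>+\<omega>. F (restrict \<omega> {0..<Suc n}) (\<omega> (n + m)) \<partial>chain_law M P \<mu>)
    = (\<integral>\<^sup>+\<omega>. expect m (F (restrict \<omega> {0..<Suc n})) (\<omega> n) \<partial>chain_law M P \<mu>)"
  using assms(2)
proof (induction m arbitrary: F)
  case 0
  show ?case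
  proof (intro nn_integral_cong)
    fix \<omega> assume "\<omega> \<in> space (chain_law M P \<mu>)"
    then have "\<omega> n \<in> space M" "restrict \<omega> {0..<Suc n} \<in> space (PiM {0..<Suc n} (\<lambda>_. M))"
      by (auto simp: space_chain_law[OF \<mu>] space_PiM PiE_iff)
    then show "F (restrict \<omega> {0..<Suc n}) (\<omega> (n + 0)) = expect 0 (F (restrict \<omega> {0..<Suc n})) (\<omega> n)"
      using measurable_Pair2[OF 0] by (subst expect_0) auto
  qed
next
  case (Suc m)
  note F[measurable] = Suc(2)
  have [measurable]: "P \<in> M \<rightarrow>\<^sub>M subprob_algebra M"
    by (rule measurable_prob_algebraD[OF kernel])
  let ?F = "\<lambda>w. F (restrict w {0..<Suc n})"
  have rr: "restrict (restrict \<omega> {0..<Suc (n + m)}) {0..<Suc n} = restrict \<omega> {0..<Suc n}" for \<omega> :: "nat \<Rightarrow> 'a"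
    by auto
  have [measurable]: "(\<lambda>w. restrict w {0..<Suc n}) \<in> PiM {0..<Suc (n + m)} (\<lambda>_. M) \<rightarrow>\<^sub>M PiM {0..<Suc n} (\<lambda>_. M)"
    by (rule measurable_restrict_subset) auto
  have "case_prod ?F \<in> borel_measurable (PiM {0..<Suc (n + m)} (\<lambda>_. M) \<Otimes>\<^sub>M M)" by measurable
  from markov_property_Suc[OF \<mu> this]
  have "(\<integral>\<^sup>+\<omega>. F (restrict \<omega> {0..<Suc n}) (\<omega> (n + Suc m)) \<partial>chain_law M P \<mu>)
    = (\<integral>\<^sup>+\<omega>. \<integral>\<^sup>+y. F (restrict \<omega> {0..<Suc n}) y \<partial>P (\<omega> (n + m)) \<partial>chain_law M P \<mu>)"
    unfolding rr by simp
  also have "\<dots> = (\<integral>\<^sup>+\<omega>. expect m (\<lambda>x. \<integral>\<^sup>+y. F (restrict \<omega> {0..<Suc n}) y \<partial>P x) (\<omega> n) \<partial>chain_law M P \<mu>)"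
  proof (rule Suc.IH)
    show "(\<lambda>(w, x). \<integral>\<^sup>+y. F w y \<partial>P x) \<in> borel_measurable (PiM {0..<Suc n} (\<lambda>_. M) \<Otimes>\<^sub>M M)"
      unfolding split_beta' by (rule nn_integral_measurable_subprob_algebra2[where N=M]) measurable
  qed
  also have "\<dots> = (\<integral>\<^sup>+\<omega>. expect (Suc m) (F (restrict \<omega> {0..<Suc n})) (\<omega> n) \<partial>chain_law M P \<mu>)"
  proof (intro nn_integral_cong)
    fix \<omega> assume "\<omega> \<in> space (chain_law M P \<mu>)"
    then have "\<omega> n \<in> space M" "restrict \<omega> {0..<Suc n} \<in> space (PiM {0..<Suc n} (\<lambda>_. M))"
      by (auto simp: space_chain_law[OF \<mu>] space_PiM PiE_iff)
    then show "expect m (\<lambda>x. \<integral>\<^sup>+y. F (restrict \<omega> {0..<Suc n}) y \<partial>P x) (\<omega> n)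
        = expect (Suc m) (F (restrict \<omega> {0..<Suc n})) (\<omega> n)"
      using measurable_Pair2[OF F] by (subst expect_Suc) auto
  qed
  finally show ?case .
qed

lemma nn_integral_chain_law_component:
  assumes \<mu>: "\<mu> \<in> space (prob_algebra M)" and f[measurable]: "f \<in> borel_measurable M"
  shows "(\<integral>\<^sup>+\<omega>. f (\<omega> n) \<partial>chain_law M P \<mu>) = (\<integral>\<^sup>+x. expect n f x \<partial>\<mu>)"
  using markov_property[OF \<mu>, of "\<lambda>_. f" 0 n] nn_integral_chain_law_initial[OF \<mu>, of "expect n f"]
  by simp

end

subsection \<open>Return times under a drift condition\<close>

lemma suminf_Suc_le:
  fixes f :: "nat \<Rightarrow> ennreal"
  shows "(\<Sum>n. f (Suc n)) \<le> (\<Sum>n. f n)"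
proof (rule suminf_le_const[OF summableI])
  fix n
  have "(\<Sum>i<n. f (Suc i)) \<le> f 0 + (\<Sum>i<n. f (Suc i))" by simp
  also have "\<dots> = (\<Sum>i<Suc n. f i)" by (rule sum.lessThan_Suc_shift[symmetric])
  also have "\<dots> \<le> (\<Sum>n. f n)" by (intro sum_le_suminf summableI) auto
  finally show "(\<Sum>i<n. f (Suc i)) \<le> (\<Sum>n. f n)" .
qed

lemma power_enat_return_time:
  assumes "n \<ge> 1" "\<omega> n \<in> D" "\<And>i. 1 \<le> i \<Longrightarrow> i < n \<Longrightarrow> \<omega> i \<notin> D"
  shows "power_enat \<kappa> (return_time D \<omega>) = ennreal (\<kappa> ^ n)"
proof -
  have "return_time D \<omega> = enat n" unfolding return_time_def
  proof (rule antisym)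
    show "Inf {enat n |n. 1 \<le> n \<and> \<omega> n \<in> D} \<le> enat n" using assms by (intro Inf_lower) auto
    show "enat n \<le> Inf {enat n |n. 1 \<le> n \<and> \<omega> n \<in> D}"
      using assms(3) by (intro Inf_greatest) (force simp: not_less[symmetric])
  qed
  then show ?thesis by (simp add: power_enat_def)
qed

context markov_kernel
begin

text \<open>From time 1 on, \<kappa>^n V(X_n) stopped at the return to \<open>D\<close> is a
  supermartingale, and V \<ge> 1 lets it dominate \<kappa> to the return time. The start
  \<open>x\<close> may lie in \<open>D\<close>, where no drift is assumed; hence the bound is the
  expectation at time 1 and not V x.\<close>

lemma return_time_bound:
  assumes x: "x \<in> space M" and D[measurable]: "D \<in> sets M"
    and V[measurable]: "V \<in> borel_measurable M" and V1: "\<And>y. y \<in> space M \<Longrightarrow> 1 \<le> V y"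
    and \<kappa>: "\<kappa> > 1"
    and drift: "\<And>y. y \<in> space M \<Longrightarrow> y \<notin> D \<Longrightarrow> ennreal \<kappa> * expect 1 V y \<le> V y"
  shows "(\<integral>\<^sup>+\<omega>. power_enat \<kappa> (return_time D \<omega>) \<partial>chain_law_from M P x) \<le> ennreal \<kappa> * expect 1 V x"
proof -
  define \<mu> where "\<mu> = return M x"
  have \<mu>: "\<mu> \<in> space (prob_algebra M)"
    using x measurable_space[OF measurable_return_prob_space, of x M] by (simp add: \<mu>_def)
  define Om where "Om = chain_law M P \<mu>"
  note mc[measurable] = measurable_component_chain_law[OF \<mu>, folded Om_def]
  \<comment> \<open>The return time is at least \<open>n\<close>. Time 0 is left out, in accordance
    with \<open>return_time\<close>, and time \<open>n\<close> itself is still open.\<close>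
  define T :: "nat \<Rightarrow> (nat \<Rightarrow> 'a) \<Rightarrow> bool" where "T n \<omega> \<longleftrightarrow> (\<forall>i\<in>{1..<n}. \<omega> i \<notin> D)" for n \<omega>
  have T_meas[measurable]: "Measurable.pred Om (T n)" for n unfolding T_def by measurable
  have om: "\<omega> n \<in> space M" if "\<omega> \<in> space Om" for \<omega> n
    using that by (auto simp: Om_def space_chain_law[OF \<mu>] space_PiM)
  have comp: "(\<integral>\<^sup>+\<omega>. f (\<omega> n) \<partial>Om) = expect n f x" if [measurable]: "f \<in> borel_measurable M" for f n
    unfolding Om_def using x
    by (subst nn_integral_chain_law_component[OF \<mu>]) (auto simp: \<mu>_def nn_integral_return)
  let ?k = "\<lambda>n. ennreal (\<kappa> ^ n)"
  define S where "S n = (\<integral>\<^sup>+\<omega>. ?k n * V (\<omega> n) * of_bool (T n \<omega>) \<partial>Om)" for n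
  define e where "e n = (\<integral>\<^sup>+\<omega>. ?k n * of_bool (T n \<omega> \<and> \<omega> n \<in> D) \<partial>Om)" for n
  have S1: "S 1 = ennreal \<kappa> * expect 1 V x"
    using comp[of "\<lambda>y. ennreal \<kappa> * V y" 1] x by (simp add: S_def T_def expect_cmult)
  \<comment> \<open>With \<tau> the return time, S n = E(\<kappa>^n V(X_n); \<tau> \<ge> n) and e n
    = E(\<kappa>^n; \<tau> = n). If X_n lies in \<open>D\<close>, V \<ge> 1 pays for e n; otherwise
    the drift condition pays for S (n+1).\<close>
  have step: "S (Suc n) + e n \<le> S n" if "n \<ge> 1" for n
  proof -
    define F where "F w y = ?k (Suc n) * V y * of_bool (T (Suc n) w)" for w y
    have "Measurable.pred (PiM {0..<Suc n} (\<lambda>_. M)) (T (Suc n))"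
      unfolding T_def
    proof (intro pred_intros_finite)
      fix i assume "i \<in> {1..<Suc n}"
      then have [measurable]: "(\<lambda>\<omega>. \<omega> i) \<in> PiM {0..<Suc n} (\<lambda>_. M) \<rightarrow>\<^sub>M M"
        by (intro measurable_component_singleton) auto
      show "Measurable.pred (PiM {0..<Suc n} (\<lambda>_. M)) (\<lambda>\<omega>. \<omega> i \<notin> D)" by measurable
    qed simp
    then have F: "case_prod F \<in> borel_measurable (PiM {0..<Suc n} (\<lambda>_. M) \<Otimes>\<^sub>M M)"
      unfolding F_def by measurable
    have T_r: "T (Suc n) (restrict \<omega> {0..<Suc n}) = T (Suc n) \<omega>" for \<omega>
      by (auto simp: T_def)
    have "S (Suc n) = (\<integral>\<^sup>+\<omega>. F (restrict \<omega> {0..<Suc n}) (\<omega> (n + 1)) \<partial>Om)"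
      by (simp add: S_def F_def T_r del: restrict_apply)
    also have "\<dots> = (\<integral>\<^sup>+\<omega>. expect 1 (F (restrict \<omega> {0..<Suc n})) (\<omega> n) \<partial>Om)"
      unfolding Om_def by (rule markov_property[OF \<mu> F])
    also have "\<dots> \<le> (\<integral>\<^sup>+\<omega>. ?k n * V (\<omega> n) * of_bool (T (Suc n) \<omega>) \<partial>Om)"
    proof (intro nn_integral_mono)
      fix \<omega> assume \<omega>: "\<omega> \<in> space Om"
      have "expect 1 (F (restrict \<omega> {0..<Suc n})) (\<omega> n) = expect 1 (\<lambda>y. (?k (Suc n) * of_bool (T (Suc n) \<omega>)) * V y) (\<omega> n)"
        by (intro expect_cong om \<omega>) (simp add: F_def T_r ac_simps del: restrict_apply)
      also have "\<dots> = (?k (Suc n) * of_bool (T (Suc n) \<omega>)) * expect 1 V (\<omega> n)"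
        by (intro expect_cmult om \<omega> V)
      also have "\<dots> = ?k n * of_bool (T (Suc n) \<omega>) * (ennreal \<kappa> * expect 1 V (\<omega> n))"
        using \<kappa> by (simp add: ennreal_mult ac_simps)
      also have "\<dots> \<le> ?k n * of_bool (T (Suc n) \<omega>) * V (\<omega> n)"
        using drift[OF om[OF \<omega>, of n]] that
        by (cases "T (Suc n) \<omega>") (auto simp: T_def intro!: mult_left_mono)
      finally show "expect 1 (F (restrict \<omega> {0..<Suc n})) (\<omega> n) \<le> ?k n * V (\<omega> n) * of_bool (T (Suc n) \<omega>)"
        by (simp add: ac_simps)
    qed
    finally have "S (Suc n) + e n \<le> (\<integral>\<^sup>+\<omega>. ?k n * V (\<omega> n) * of_bool (T (Suc n) \<omega>) \<partial>Om) + e n"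
      by (rule add_right_mono)
    also have "\<dots> = (\<integral>\<^sup>+\<omega>. ?k n * V (\<omega> n) * of_bool (T (Suc n) \<omega>) + ?k n * of_bool (T n \<omega> \<and> \<omega> n \<in> D) \<partial>Om)"
      unfolding e_def by (rule nn_integral_add[symmetric]) measurable
    also have "\<dots> \<le> S n"
      unfolding S_def
    proof (intro nn_integral_mono)
      fix \<omega> assume \<omega>: "\<omega> \<in> space Om"
      have "T (Suc n) \<omega> \<longleftrightarrow> T n \<omega> \<and> \<omega> n \<notin> D" using that by (auto simp: T_def less_Suc_eq)
      moreover have "?k n * 1 \<le> ?k n * V (\<omega> n)" by (intro mult_left_mono V1 om \<omega>) simp
      ultimately show "?k n * V (\<omega> n) * of_bool (T (Suc n) \<omega>) + ?k n * of_bool (T n \<omega> \<and> \<omega> n \<in> D)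
          \<le> ?k n * V (\<omega> n) * of_bool (T n \<omega>)"
        by auto
    qed
    finally show ?thesis .
  qed
  have part: "S (Suc n) + (\<Sum>i<n. e (Suc i)) \<le> S 1" for n
  proof (induction n)
    case (Suc n)
    have "S (Suc (Suc n)) + (\<Sum>i<Suc n. e (Suc i)) = (S (Suc (Suc n)) + e (Suc n)) + (\<Sum>i<n. e (Suc i))"
      by (simp add: ac_simps)
    also have "\<dots> \<le> S (Suc n) + (\<Sum>i<n. e (Suc i))" by (intro add_right_mono step) simp
    also have "\<dots> \<le> S 1" by (rule Suc)
    finally show ?case .
  qed simp
  have e_sum: "(\<Sum>i. e (Suc i)) \<le> S 1"
  proof (rule suminf_le_const[OF summableI])
    show "(\<Sum>i<n. e (Suc i)) \<le> S 1" for n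
      by (rule order_trans[OF _ part[of n]]) simp
  qed
  have S_le: "S (Suc n) \<le> S 1" for n by (rule order_trans[OF _ part[of n]]) simp
  show ?thesis
  proof (cases "S 1 = \<infinity>")
    case True
    then show ?thesis unfolding S1[symmetric] by simp
  next
    case False
    then obtain s where s: "S 1 = ennreal s" "s \<ge> 0" by (cases "S 1") auto
    \<comment> \<open>The paths that never return, where the integrand is infinite. They are null
      because \<kappa>^n times their mass stays below the finite number S 1.\<close>
    define U where "U = {\<omega>\<in>space Om. \<forall>n. T n \<omega>}"
    have U[measurable]: "U \<in> sets Om" unfolding U_def by measurable
    have "emeasure Om U \<le> ennreal (s * (1 / \<kappa>) ^ Suc n)" for n
    proof -
      have "?k (Suc n) * emeasure Om U = (\<integral>\<^sup>+\<omega>. ?k (Suc n) * indicator U \<omega> \<partial>Om)"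
        by (subst nn_integral_cmult_indicator) measurable
      also have "\<dots> \<le> S (Suc n)"
        unfolding S_def
      proof (intro nn_integral_mono)
        fix \<omega> assume \<omega>: "\<omega> \<in> space Om"
        have "?k (Suc n) * 1 \<le> ?k (Suc n) * V (\<omega> (Suc n))" by (intro mult_left_mono V1 om \<omega>) simp
        then show "?k (Suc n) * indicator U \<omega> \<le> ?k (Suc n) * V (\<omega> (Suc n)) * of_bool (T (Suc n) \<omega>)"
          by (auto simp: U_def indicator_def)
      qed
      also have "\<dots> \<le> ennreal s" using S_le s by simp
      finally have *: "?k (Suc n) * emeasure Om U \<le> ennreal s" .
      have "emeasure Om U = ennreal ((1 / \<kappa>) ^ Suc n) * (?k (Suc n) * emeasure Om U)"
        using \<kappa> by (simp add: mult.assoc[symmetric] ennreal_mult[symmetric] power_one_over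
          divide_simps del: power_Suc)
      also have "\<dots> \<le> ennreal ((1 / \<kappa>) ^ Suc n) * ennreal s"
        by (intro mult_left_mono *) simp
      finally show ?thesis using \<kappa> s by (simp add: ennreal_mult[symmetric] ac_simps)
    qed
    moreover have "(\<lambda>n. ennreal (s * (1 / \<kappa>) ^ Suc n)) \<longlonglongrightarrow> ennreal (s * 0)"
      using \<kappa> by (intro tendsto_ennrealI tendsto_intros LIMSEQ_Suc LIMSEQ_power_zero) auto
    ultimately have "emeasure Om U \<le> ennreal (s * 0)"
      by (intro LIMSEQ_le_const) auto
    then have "U \<in> null_sets Om" by (simp add: null_sets_def)
    then have AEU: "AE \<omega> in Om. \<omega> \<notin> U" by (rule AE_not_in)
    have "(\<integral>\<^sup>+\<omega>. power_enat \<kappa> (return_time D \<omega>) \<partial>Om)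
      \<le> (\<integral>\<^sup>+\<omega>. (\<Sum>i. ?k (Suc i) * of_bool (T (Suc i) \<omega> \<and> \<omega> (Suc i) \<in> D)) \<partial>Om)"
    proof (rule nn_integral_mono_AE)
      show "AE \<omega> in Om. power_enat \<kappa> (return_time D \<omega>)
          \<le> (\<Sum>i. ?k (Suc i) * of_bool (T (Suc i) \<omega> \<and> \<omega> (Suc i) \<in> D))"
        using AEU AE_space[of Om]
      proof eventually_elim
        case (elim \<omega>)
        then obtain n i where "i \<in> {1..<n}" "\<omega> i \<in> D" by (auto simp: U_def T_def)
        then have ex: "\<exists>i. 1 \<le> i \<and> \<omega> i \<in> D" by auto
        define l where "l = (LEAST i. 1 \<le> i \<and> \<omega> i \<in> D)"
        have l: "1 \<le> l" "\<omega> l \<in> D" using LeastI_ex[OF ex] by (auto simp: l_def)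
        have l2: "\<omega> i \<notin> D" if "1 \<le> i" "i < l" for i
          using that not_less_Least[of i "\<lambda>i. 1 \<le> i \<and> \<omega> i \<in> D"] by (auto simp: l_def)
        obtain l' where l': "l = Suc l'" using l by (cases l) auto
        let ?f = "\<lambda>i. ?k (Suc i) * of_bool (T (Suc i) \<omega> \<and> \<omega> (Suc i) \<in> D)"
        have "power_enat \<kappa> (return_time D \<omega>) = ?f l'"
          using power_enat_return_time[of l \<omega> D \<kappa>] l l2 by (simp add: l' T_def)
        also have "\<dots> = (\<Sum>i\<in>{l'}. ?f i)" by simp
        also have "\<dots> \<le> (\<Sum>i. ?f i)" by (rule sum_le_suminf[OF summableI]) auto
        finally show ?case .
      qed
    qed
    also have "\<dots> = (\<Sum>i. e (Suc i))"
      unfolding e_def by (rule nn_integral_suminf) measurable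
    finally show ?thesis using e_sum unfolding S1[symmetric] by (simp add: Om_def \<mu>_def chain_law_from_def)
  qed
qed

end

subsection \<open>Regeneration times\<close>

locale minorized_chain = positive_chain +
  fixes C :: "'a set" and m :: nat and \<nu> :: "'a measure" and \<delta> :: real
  assumes C[measurable]: "C \<in> sets M" and C_pos: "emeasure \<pi> C > 0" and m: "0 < m"
    and \<nu>: "\<nu> \<in> space (prob_algebra M)" and \<delta>: "0 < \<delta>" "\<delta> < 1"
    and minorization: "\<And>x A. x \<in> C \<Longrightarrow> A \<in> sets M \<Longrightarrow>
      ennreal \<delta> * emeasure \<nu> A \<le> emeasure (kernel_power M P m x) A"
begin

lemma sets_nu[measurable_cong]: "sets \<nu> = sets M"
  using \<nu> by (simp add: space_prob_algebra)

lemma space_nu: "space \<nu> = space M"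
  by (rule sets_eq_imp_space_eq[OF sets_nu])

sublocale nu: prob_space \<nu>
  using \<nu> by (simp add: space_prob_algebra)

lemma minorization_nn_integral:
  assumes x: "x \<in> space M" and f[measurable]: "f \<in> borel_measurable M"
  shows "ennreal \<delta> * indicator C x * (\<integral>\<^sup>+y. f y \<partial>\<nu>) \<le> expect m f x"
proof (cases "x \<in> C")
  case True
  have "scale_measure (ennreal \<delta>) \<nu> \<le> kernel_power M P m x"
    using minorization[OF True] sets_kernel_power[OF x] sets_nu
    by (intro le_measure[THEN iffD2]) auto
  then have "(\<integral>\<^sup>+y. f y \<partial>scale_measure (ennreal \<delta>) \<nu>) \<le> expect m f x"
    unfolding expect_def using sets_kernel_power[OF x] sets_nu by (intro nn_integral_mono_measure) auto
  then show ?thesis using True by (simp add: nn_integral_scale_measure)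
qed simp

text \<open>The residual operator \<open>f \<mapsto> P\<^sup>m f - \<delta> 1\<^sub>C \<nu>(f)\<close> is monotone; here both sides are moved
  so that no subtraction of extended reals occurs.\<close>

lemma residual_mono:
  assumes x: "x \<in> space M" and [measurable]: "f \<in> borel_measurable M" "f' \<in> borel_measurable M"
    and le: "\<And>y. y \<in> space M \<Longrightarrow> f y \<le> f' y"
  shows "expect m f x + ennreal \<delta> * indicator C x * (\<integral>\<^sup>+y. f' y \<partial>\<nu>)
    \<le> expect m f' x + ennreal \<delta> * indicator C x * (\<integral>\<^sup>+y. f y \<partial>\<nu>)"
proof -
  \<comment> \<open>Positivity of the residual operator is the minorization applied to this
    difference; f' = f + d holds also at infinite values.\<close>
  define d where "d y = f' y - f y" for y
  have [measurable]: "d \<in> borel_measurable M" unfolding d_def by measurable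
  have fd: "f' y = f y + d y" if "y \<in> space M" for y
    using le[OF that] by (simp add: d_def add_diff_inverse_ennreal)
  have "(\<integral>\<^sup>+y. f' y \<partial>\<nu>) = (\<integral>\<^sup>+y. f y + d y \<partial>\<nu>)"
    by (intro nn_integral_cong fd) (simp add: space_nu)
  also have "\<dots> = (\<integral>\<^sup>+y. f y \<partial>\<nu>) + (\<integral>\<^sup>+y. d y \<partial>\<nu>)" by (rule nn_integral_add) measurable
  finally have 1: "(\<integral>\<^sup>+y. f' y \<partial>\<nu>) = (\<integral>\<^sup>+y. f y \<partial>\<nu>) + (\<integral>\<^sup>+y. d y \<partial>\<nu>)" .
  have "expect m f' x = expect m (\<lambda>y. f y + d y) x"
    by (intro expect_cong x fd)
  also have "\<dots> = expect m f x + expect m d x" using x by (simp add: expect_add)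
  finally have 2: "expect m f' x = expect m f x + expect m d x" .
  have "ennreal \<delta> * indicator C x * (\<integral>\<^sup>+y. d y \<partial>\<nu>) \<le> expect m d x"
    by (rule minorization_nn_integral[OF x]) measurable
  then have "(expect m f x + ennreal \<delta> * indicator C x * (\<integral>\<^sup>+y. f y \<partial>\<nu>)) + ennreal \<delta> * indicator C x * (\<integral>\<^sup>+y. d y \<partial>\<nu>)
      \<le> (expect m f x + ennreal \<delta> * indicator C x * (\<integral>\<^sup>+y. f y \<partial>\<nu>)) + expect m d x"
    by (rule add_left_mono)
  then show ?thesis unfolding 1 2 by (simp add: distrib_left ac_simps)
qed

text \<open>The probability that the chain split at \<open>C\<close> and observed at multiples of \<open>m\<close> has not
  regenerated during its first \<open>k\<close> steps.\<close>

primrec residual :: "nat \<Rightarrow> 'a \<Rightarrow> ennreal" where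
  "residual 0 x = 1"
| "residual (Suc k) x = expect m (residual k) x - ennreal \<delta> * indicator C x * (\<integral>\<^sup>+y. residual k y \<partial>\<nu>)"

lemma measurable_residual[measurable]: "residual k \<in> borel_measurable M"
proof (induction k)
  case 0
  have "residual 0 = (\<lambda>_. 1)" by auto
  then show ?case by simp
next
  case (Suc k)
  note [measurable] = Suc
  have "residual (Suc k) = (\<lambda>x. expect m (residual k) x - ennreal \<delta> * indicator C x * (\<integral>\<^sup>+y. residual k y \<partial>\<nu>))"
    by auto
  then show ?case by simp
qed

lemma residual_le_1: "x \<in> space M \<Longrightarrow> residual k x \<le> 1"
proof (induction k arbitrary: x)
  case (Suc k)
  have "residual (Suc k) x \<le> expect m (residual k) x" by (simp add: diff_le_self_ennreal)
  also have "\<dots> \<le> expect m (\<lambda>_. 1) x" using Suc by (intro expect_mono) auto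
  finally show ?case using Suc(2) by (simp add: expect_const)
qed simp

lemma nn_integral_residual_le_1: "(\<integral>\<^sup>+y. residual k y \<partial>\<nu>) \<le> 1"
proof -
  have "(\<integral>\<^sup>+y. residual k y \<partial>\<nu>) \<le> (\<integral>\<^sup>+y. 1 \<partial>\<nu>)"
    using residual_le_1 by (intro nn_integral_mono) (simp add: space_nu)
  then show ?thesis by (simp add: nu.emeasure_space_1)
qed

lemma residual_term_finite: "ennreal \<delta> * indicator C x * (\<integral>\<^sup>+y. residual k y \<partial>\<nu>) < \<infinity>"
  using nn_integral_residual_le_1[of k]
  by (auto simp: ennreal_mult_less_top indicator_def le_less_trans)

text \<open>The minorization bounds the subtracted term by the minuend, so the truncated subtraction
  in \<open>residual\<close> is a true one.\<close>

lemma residual_Suc: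
  assumes "x \<in> space M"
  shows "residual (Suc k) x + ennreal \<delta> * indicator C x * (\<integral>\<^sup>+y. residual k y \<partial>\<nu>) = expect m (residual k) x"
  using minorization_nn_integral[OF assms measurable_residual[of k]]
  by (simp add: diff_add_cancel_ennreal)

text \<open>This is \<open>residual_mono\<close> between \<open>residual k\<close> and
  \<open>f\<close>, with the term in \<open>residual k\<close> cancelled, which is possible because
  it is finite. It serves as the induction step for upper bounds of \<open>residual\<close>.\<close>

lemma residual_Suc_le:
  assumes x: "x \<in> space M" and f[measurable]: "f \<in> borel_measurable M"
    and le: "\<And>y. y \<in> space M \<Longrightarrow> residual k y \<le> f y"
  shows "residual (Suc k) x + ennreal \<delta> * indicator C x * (\<integral>\<^sup>+y. f y \<partial>\<nu>) \<le> expect m f x"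
proof -
  let ?s = "ennreal \<delta> * indicator C x * (\<integral>\<^sup>+y. residual k y \<partial>\<nu>)"
  have "?s + (residual (Suc k) x + ennreal \<delta> * indicator C x * (\<integral>\<^sup>+y. f y \<partial>\<nu>))
      = (residual (Suc k) x + ?s) + ennreal \<delta> * indicator C x * (\<integral>\<^sup>+y. f y \<partial>\<nu>)"
    by (simp only: ac_simps)
  also have "\<dots> = expect m (residual k) x + ennreal \<delta> * indicator C x * (\<integral>\<^sup>+y. f y \<partial>\<nu>)"
    by (simp only: residual_Suc[OF x])
  also have "\<dots> \<le> expect m f x + ?s" by (rule residual_mono[OF x measurable_residual f le])
  also have "\<dots> = ?s + expect m f x" by (rule add.commute)
  finally have "?s + (residual (Suc k) x + ennreal \<delta> * indicator C x * (\<integral>\<^sup>+y. f y \<partial>\<nu>)) \<le> ?s + expect m f x" .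
  then show ?thesis using residual_term_finite[of x k] by (simp only: ennreal_add_left_cancel_le) auto
qed

text \<open>The probability that fewer than \<open>j\<close> of the first \<open>k\<close> times \<open>0, m, 2 m, \<dots>\<close> are spent in \<open>C\<close>.\<close>

primrec few_visits :: "nat \<Rightarrow> nat \<Rightarrow> 'a \<Rightarrow> ennreal" where
  "few_visits 0 j x = (if j = 0 then 0 else 1)"
| "few_visits (Suc k) j x = (if x \<in> C then expect m (few_visits k (j - 1)) x else expect m (few_visits k j) x)"

lemma measurable_few_visits[measurable]: "few_visits k j \<in> borel_measurable M"
proof (induction k arbitrary: j)
  case 0
  have "few_visits 0 j = (\<lambda>_. if j = 0 then 0 else 1)" by auto
  then show ?case by simp
next
  case (Suc k)
  note [measurable] = Suc
  have "few_visits (Suc k) j = (\<lambda>x. if x \<in> C then expect m (few_visits k (j - 1)) x else expect m (few_visits k j) x)"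
    by auto
  then show ?case by simp
qed

text \<open>Every visit to \<open>C\<close> is a regeneration with probability \<open>\<delta>\<close>.\<close>

lemma residual_le_few_visits:
  "x \<in> space M \<Longrightarrow> residual k x \<le> ennreal ((1 - \<delta>) ^ j) + few_visits k j x"
proof (induction k arbitrary: j x)
  case (Suc k)
  have *: "expect m (\<lambda>y. ennreal a + few_visits k i y) x = ennreal a + expect m (few_visits k i) x" for a i
    using Suc(2) by (simp add: expect_add expect_const)
  show ?case
  proof (cases "x \<in> C \<and> j > 0")
    case True
    then obtain i where j: "j = Suc i" by (cases j) auto
    define a where "a = (1 - \<delta>) ^ i"
    have a: "a \<ge> 0" using \<delta> by (simp add: a_def)
    have "ennreal a = (\<integral>\<^sup>+y. ennreal a \<partial>\<nu>)" by (simp add: nu.emeasure_space_1)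
    also have "\<dots> \<le> (\<integral>\<^sup>+y. ennreal a + few_visits k i y \<partial>\<nu>)" by (intro nn_integral_mono) auto
    finally have "residual (Suc k) x + ennreal \<delta> * ennreal a
        \<le> residual (Suc k) x + ennreal \<delta> * indicator C x * (\<integral>\<^sup>+y. ennreal a + few_visits k i y \<partial>\<nu>)"
      using True by (intro add_left_mono) (auto intro: mult_left_mono)
    also have "\<dots> \<le> expect m (\<lambda>y. ennreal a + few_visits k i y) x"
      using Suc by (intro residual_Suc_le) (auto simp: a_def)
    also have "\<dots> = ennreal a + expect m (few_visits k i) x" by (rule *)
    finally have 1: "residual (Suc k) x + ennreal \<delta> * ennreal a \<le> ennreal a + expect m (few_visits k i) x" .
    \<comment> \<open>On a visit the residual operator maps the constant \<open>a\<close> to (1 -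
      \<delta>) a, which turns the power i into j = i + 1. The part with \<open>few_visits\<close>
      is bounded by P^m alone.\<close>
    have 2: "ennreal a = ennreal ((1 - \<delta>) * a) + ennreal \<delta> * ennreal a"
    proof -
      have "ennreal ((1 - \<delta>) * a + \<delta> * a) = ennreal ((1 - \<delta>) * a) + ennreal (\<delta> * a)"
        using \<delta> a by (intro ennreal_plus) auto
      moreover have "(1 - \<delta>) * a + \<delta> * a = a" by (simp add: algebra_simps)
      moreover have "ennreal (\<delta> * a) = ennreal \<delta> * ennreal a" using \<delta> by (intro ennreal_mult') auto
      ultimately show ?thesis by simp
    qed
    have "ennreal \<delta> * ennreal a + residual (Suc k) x \<le> ennreal a + expect m (few_visits k i) x"
      using 1 by (subst add.commute)
    also have "\<dots> = (ennreal ((1 - \<delta>) * a) + ennreal \<delta> * ennreal a) + expect m (few_visits k i) x"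
      by (rule arg_cong[where f="\<lambda>z. z + expect m (few_visits k i) x", OF 2])
    also have "\<dots> = ennreal \<delta> * ennreal a + (ennreal ((1 - \<delta>) * a) + expect m (few_visits k i) x)"
      by (simp only: ac_simps)
    finally have "ennreal \<delta> * ennreal a + residual (Suc k) x
      \<le> ennreal \<delta> * ennreal a + (ennreal ((1 - \<delta>) * a) + expect m (few_visits k i) x)" .
    then have "residual (Suc k) x \<le> ennreal ((1 - \<delta>) * a) + expect m (few_visits k i) x"
      by (simp only: ennreal_add_left_cancel_le) (auto simp: ennreal_mult_eq_top_iff)
    then show ?thesis using True by (simp add: j a_def del: residual.simps)
  next
    case False
    show ?thesis
    proof (cases "j = 0")
      case True
      have "residual (Suc k) x \<le> 1" by (rule residual_le_1[OF Suc(2)])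
      also have "1 \<le> ennreal ((1 - \<delta>) ^ j) + few_visits (Suc k) j x" using True by simp
      finally show ?thesis .
    next
      case j: False
      then have x: "x \<notin> C" using False by simp
      have "residual (Suc k) x \<le> expect m (residual k) x" by (simp add: diff_le_self_ennreal)
      also have "\<dots> \<le> expect m (\<lambda>y. ennreal ((1 - \<delta>) ^ j) + few_visits k j y) x"
        using Suc by (intro expect_mono) auto
      also have "\<dots> = ennreal ((1 - \<delta>) ^ j) + few_visits (Suc k) j x" using x by (simp add: *)
      finally show ?thesis .
    qed
  qed
qed simp

section \<open>Visits along the path and the concentration inequality\<close>

definition visits :: "nat \<Rightarrow> (nat \<Rightarrow> 'a) \<Rightarrow> nat" where
  "visits k \<omega> = (\<Sum>i<k. indicator C (\<omega> (m * i)))"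

lemma measurable_visits:
  assumes [measurable]: "\<And>i. i < k \<Longrightarrow> (\<lambda>\<omega>. \<omega> (m * i)) \<in> N \<rightarrow>\<^sub>M M"
  shows "visits k \<in> N \<rightarrow>\<^sub>M count_space UNIV"
  using assms
proof (induction k)
  case 0
  have "visits 0 = (\<lambda>_. 0)" by (auto simp: visits_def)
  then show ?case by simp
next
  case (Suc k)
  have [measurable]: "visits k \<in> N \<rightarrow>\<^sub>M count_space UNIV" by (intro Suc) auto
  have [measurable]: "(\<lambda>\<omega>. \<omega> (m * k)) \<in> N \<rightarrow>\<^sub>M M" by (intro Suc) auto
  have "visits (Suc k) = (\<lambda>\<omega>. if \<omega> (m * k) \<in> C then Suc (visits k \<omega>) else visits k \<omega>)"
    by (auto simp: visits_def)
  then show ?case by simp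
qed

lemma nn_integral_few_visits:
  "(\<integral>\<^sup>+x. few_visits k j x \<partial>\<pi>)
    = emeasure (chain_law M P \<pi>) {\<omega> \<in> space (chain_law M P \<pi>). visits k \<omega> < j}"
proof -
  let ?Om = "chain_law M P \<pi>"
  note mc = measurable_component_chain_law[OF prob_algebra_pi]
  have om: "\<omega> n \<in> space M" if "\<omega> \<in> space ?Om" for \<omega> n
    using that by (auto simp: space_chain_law[OF prob_algebra_pi] space_PiM)
  \<comment> \<open>The recursion unfolded along the path: after i sampled times, k - i remain and
    the threshold has dropped by the visits so far. Subtraction on \<open>nat\<close> stops at 0,
    where \<open>few_visits\<close> is 0. The case i = k is the claim.\<close>
  have "i \<le> k \<Longrightarrow> (\<integral>\<^sup>+x. few_visits k j x \<partial>\<pi>) = (\<integral>\<^sup>+\<omega>. few_visits (k - i) (j - visits i \<omega>) (\<omega> (m * i)) \<partial>?Om)" for i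
  proof (induction i)
    case 0
    show ?case by (simp add: visits_def nn_integral_chain_law_initial[OF prob_algebra_pi])
  next
    case (Suc i)
    define l where "l = k - Suc i"
    have ki: "k - i = Suc l" using Suc(2) by (simp add: l_def)
    define F where "F w y = few_visits l (j - visits (Suc i) w) y" for w y
    have F: "case_prod F \<in> borel_measurable (PiM {0..<Suc (m * i)} (\<lambda>_. M) \<Otimes>\<^sub>M M)"
    proof -
      have [measurable]: "visits (Suc i) \<in> PiM {0..<Suc (m * i)} (\<lambda>_. M) \<rightarrow>\<^sub>M count_space UNIV"
        by (intro measurable_visits measurable_component_singleton) (auto simp: less_Suc_eq_le)
      have "(\<lambda>p. few_visits l (j - n) (snd p)) \<in> borel_measurable (PiM {0..<Suc (m * i)} (\<lambda>_. M) \<Otimes>\<^sub>M M)" for n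
        by measurable
      then have "(\<lambda>p. few_visits l (j - visits (Suc i) (fst p)) (snd p)) \<in> borel_measurable (PiM {0..<Suc (m * i)} (\<lambda>_. M) \<Otimes>\<^sub>M M)"
        by (rule measurable_compose_countable) measurable
      then show ?thesis by (simp add: F_def split_beta')
    qed
    have vr: "visits (Suc i) (restrict \<omega> {0..<Suc (m * i)}) = visits (Suc i) \<omega>" for \<omega>
      unfolding visits_def by (intro sum.cong) (auto simp: less_Suc_eq_le)
    have "(\<integral>\<^sup>+x. few_visits k j x \<partial>\<pi>) = (\<integral>\<^sup>+\<omega>. few_visits (Suc l) (j - visits i \<omega>) (\<omega> (m * i)) \<partial>?Om)"
      using Suc by (simp add: ki)
    also have "\<dots> = (\<integral>\<^sup>+\<omega>. expect m (F (restrict \<omega> {0..<Suc (m * i)})) (\<omega> (m * i)) \<partial>?Om)"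
      unfolding F_def vr by (intro nn_integral_cong) (simp add: visits_def)
    also have "\<dots> = (\<integral>\<^sup>+\<omega>. F (restrict \<omega> {0..<Suc (m * i)}) (\<omega> (m * i + m)) \<partial>?Om)"
      by (rule markov_property[OF prob_algebra_pi F, symmetric])
    finally show ?case unfolding F_def vr by (simp add: l_def add.commute)
  qed
  from this[of k] have "(\<integral>\<^sup>+x. few_visits k j x \<partial>\<pi>) = (\<integral>\<^sup>+\<omega>. (if j - visits k \<omega> = 0 then 0 else 1) \<partial>?Om)"
    by simp
  also have "\<dots> = (\<integral>\<^sup>+\<omega>. indicator {\<omega> \<in> space ?Om. visits k \<omega> < j} \<omega> \<partial>?Om)"
    by (intro nn_integral_cong) (auto simp: indicator_def)
  also have "\<dots> = emeasure ?Om {\<omega> \<in> space ?Om. visits k \<omega> < j}"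
  proof (rule nn_integral_indicator)
    have [measurable]: "visits k \<in> ?Om \<rightarrow>\<^sub>M count_space UNIV"
      by (intro measurable_visits mc)
    show "{\<omega> \<in> space ?Om. visits k \<omega> < j} \<in> sets ?Om" by measurable
  qed
  finally show ?thesis .
qed

lemma few_visits_tail:
  fixes M\<^sub>0 :: real
  assumes M\<^sub>0: "M\<^sub>0 > 0"
    and conc: "\<And>(n::nat) (K :: (nat \<Rightarrow> 'a) \<Rightarrow> real) (L :: nat \<Rightarrow> real) (t::real).
      K \<in> borel_measurable (PiM {..<n} (\<lambda>_. M)) \<Longrightarrow>
      (\<forall>i<n. L i \<ge> 0) \<Longrightarrow>
      separately_bounded M n K L \<Longrightarrow>
      t > 0 \<Longrightarrow>
      measure (chain_law M P \<pi>)
        {\<omega> \<in> space (chain_law M P \<pi>).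
          \<bar>K (restrict \<omega> {..<n}) - (\<integral>\<omega>'. K (restrict \<omega>' {..<n}) \<partial>chain_law M P \<pi>)\<bar> > t}
      \<le> (if (\<Sum>i<n. (L i)\<^sup>2) = 0 then 0
         else 2 * exp (- (inverse M\<^sub>0 * t\<^sup>2 / (\<Sum>i<n. (L i)\<^sup>2))))"
    and k: "k > 0" and j: "real j < real k * measure \<pi> C / 2 + 1"
  shows "(\<integral>\<^sup>+x. few_visits k j x \<partial>\<pi>) \<le> ennreal (2 * exp (- (inverse M\<^sub>0 * (measure \<pi> C)\<^sup>2 / 4 * k)))"
proof -
  let ?Om = "chain_law M P \<pi>"
  interpret Om: prob_space ?Om by (rule prob_space_chain_law[OF prob_algebra_pi])
  note mc[measurable] = measurable_component_chain_law[OF prob_algebra_pi]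
  define p where "p = measure \<pi> C"
  have p: "p > 0" using C_pos by (simp add: p_def pi.emeasure_eq_measure)
  define K where "K \<omega> = real (visits k \<omega>)" for \<omega>
  have K_sum: "K \<omega> = (\<Sum>i<k. indicator C (\<omega> (m * i)))" for \<omega>
    unfolding K_def visits_def of_nat_sum by (intro sum.cong) (auto simp: indicator_def)
  have K_restrict: "K (restrict \<omega> {..<m * k}) = K \<omega>" for \<omega>
    unfolding K_sum using m by (intro sum.cong) auto
  \<comment> \<open>The constant of coordinate \<open>l\<close> counts the sampled times equal to
    \<open>l\<close>. As i -> m i is injective, it is 0 or 1, and the squares sum to k although K
    formally has m k arguments.\<close>
  define L where "L l = (\<Sum>i<k. of_bool (m * i = l) :: real)" for l
  have L01: "L l = of_bool (\<exists>i<k. m * i = l)" for l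
  proof (cases "\<exists>i<k. m * i = l")
    case True
    then obtain i where i: "i < k" "m * i = l" by blast
    then have "L l = (\<Sum>i'<k. if i' = i then 1 else 0)"
      unfolding L_def using m by (intro sum.cong) auto
    then show ?thesis using i True by simp
  next
    case False
    then show ?thesis unfolding L_def by (auto intro!: sum.neutral)
  qed
  have "(\<Sum>l<m * k. (L l)\<^sup>2) = (\<Sum>l<m * k. L l)" by (intro sum.cong) (auto simp: L01)
  also have "\<dots> = (\<Sum>i<k. \<Sum>l<m * k. of_bool (m * i = l))" unfolding L_def by (rule sum.swap)
  also have "\<dots> = (\<Sum>i<k. 1)"
    using m by (intro sum.cong) (auto simp: of_bool_def sum.delta')
  finally have L2: "(\<Sum>l<m * k. (L l)\<^sup>2) = real k" by simp
  have "separately_bounded M (m * k) K L"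
    unfolding separately_bounded_def
  proof (intro allI impI ballI)
    fix l x y
    have "\<bar>K x - K (x(l := y))\<bar> = \<bar>\<Sum>i<k. indicator C (x (m * i)) - indicator C ((x(l := y)) (m * i))\<bar>"
      unfolding K_sum by (simp add: sum_subtractf)
    also have "\<dots> \<le> (\<Sum>i<k. \<bar>indicator C (x (m * i)) - indicator C ((x(l := y)) (m * i))\<bar>)"
      by (rule sum_abs)
    also have "\<dots> \<le> L l" unfolding L_def by (intro sum_mono) (auto simp: indicator_def)
    finally show "\<bar>K x - K (x(l := y))\<bar> \<le> L l" .
  qed
  moreover have "K \<in> borel_measurable (PiM {..<m * k} (\<lambda>_. M))"
  proof -
    have "visits k \<in> PiM {..<m * k} (\<lambda>_. M) \<rightarrow>\<^sub>M count_space UNIV"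
      using m by (intro measurable_visits measurable_component_singleton) auto
    then show ?thesis unfolding K_def by measurable
  qed
  moreover have t: "real k * p / 2 > 0" using k p by simp
  ultimately have *: "measure ?Om {\<omega> \<in> space ?Om. real k * p / 2 < \<bar>K \<omega> - (\<integral>\<omega>'. K \<omega>' \<partial>?Om)\<bar>}
      \<le> 2 * exp (- (inverse M\<^sub>0 * (real k * p / 2)\<^sup>2 / real k))"
    using conc[of K "m * k" L "real k * p / 2"] k by (simp add: L01 L2[unfolded L01] K_restrict)
  have "(\<integral>\<omega>. indicator C (\<omega> n) \<partial>?Om) = p" for n
  proof -
    have "(\<integral>\<omega>. indicator C (\<omega> n) \<partial>?Om) = enn2real (\<integral>\<^sup>+\<omega>. ennreal (indicator C (\<omega> n)) \<partial>?Om)"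
      by (intro integral_eq_nn_integral) auto
    also have "(\<integral>\<^sup>+\<omega>. ennreal (indicator C (\<omega> n)) \<partial>?Om) = (\<integral>\<^sup>+x. expect n (indicator C) x \<partial>\<pi>)"
      using nn_integral_chain_law_component[OF prob_algebra_pi, of "indicator C" n]
      by (simp add: ennreal_indicator)
    also have "\<dots> = emeasure \<pi> C" by (simp add: nn_integral_stationary sets_pi)
    finally show ?thesis by (simp add: p_def measure_def)
  qed
  moreover have "integrable ?Om (\<lambda>\<omega>. indicator C (\<omega> n) :: real)" for n
    by (rule Om.integrable_const_bound[where B=1]) auto
  ultimately have EK: "(\<integral>\<omega>. K \<omega> \<partial>?Om) = real k * p"
    unfolding K_sum by (simp add: Bochner_Integration.integral_sum)
  have K_meas[measurable]: "K \<in> borel_measurable ?Om"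
    unfolding K_sum[abs_def] by measurable
  have "(\<integral>\<^sup>+x. few_visits k j x \<partial>\<pi>) = emeasure ?Om {\<omega> \<in> space ?Om. visits k \<omega> < j}"
    by (rule nn_integral_few_visits)
  also have "\<dots> \<le> emeasure ?Om {\<omega> \<in> space ?Om. real k * p / 2 < \<bar>K \<omega> - (\<integral>\<omega>'. K \<omega>' \<partial>?Om)\<bar>}"
  proof (intro emeasure_mono subsetI)
    fix \<omega> assume "\<omega> \<in> {\<omega> \<in> space ?Om. visits k \<omega> < j}"
    then have "\<omega> \<in> space ?Om" "K \<omega> + 1 \<le> real j" by (auto simp: K_def)
    \<comment> \<open>Counts are integers, so fewer than j visits means K + 1 \<le> j. Thus j may
      exceed half the mean k p by anything less than 1, which leaves room for rounding up.\<close>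
    moreover from this have "K \<omega> < real k * p / 2" using j unfolding p_def by linarith
    then have "real k * p / 2 < \<bar>K \<omega> - real k * p\<bar>" by linarith
    ultimately show "\<omega> \<in> {\<omega> \<in> space ?Om. real k * p / 2 < \<bar>K \<omega> - (\<integral>\<omega>'. K \<omega>' \<partial>?Om)\<bar>}"
      unfolding EK by simp
  qed measurable
  also have "\<dots> \<le> ennreal (2 * exp (- (inverse M\<^sub>0 * (real k * p / 2)\<^sup>2 / real k)))"
    unfolding Om.emeasure_eq_measure by (intro ennreal_leI *)
  also have "inverse M\<^sub>0 * (real k * p / 2)\<^sup>2 / real k = inverse M\<^sub>0 * p\<^sup>2 / 4 * k"
    using k by (simp add: power2_eq_square field_simps)
  finally show ?thesis by (simp add: p_def)
qed

lemma residual_tail: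
  fixes a :: real
  assumes a: "a > 0"
    and tail: "\<And>k j. k > 0 \<Longrightarrow> real j < real k * measure \<pi> C / 2 + 1 \<Longrightarrow>
      (\<integral>\<^sup>+x. few_visits k j x \<partial>\<pi>) \<le> ennreal (2 * exp (- (a * k)))"
  obtains c where "c > 0" "\<And>k. (\<integral>\<^sup>+x. residual k x \<partial>\<pi>) \<le> ennreal (3 * exp (- (c * real k)))"
proof
  define p where "p = measure \<pi> C"
  have p: "p > 0" using C_pos by (simp add: p_def pi.emeasure_eq_measure)
  \<comment> \<open>The smaller of two rates: \<open>a\<close> for having few visits, and \<delta> p
    / 2 for failing to regenerate at j \<ge> k p / 2 visits, since (1 - \<delta>)^j \<le>
    exp(-\<delta> j).\<close>
  define c where "c = min a (\<delta> * p / 2)"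
  show "c > 0" using a \<delta> p by (simp add: c_def)
  show "(\<integral>\<^sup>+x. residual k x \<partial>\<pi>) \<le> ennreal (3 * exp (- (c * real k)))" for k
  proof (cases "k = 0")
    case True
    then show ?thesis by (simp add: pi.emeasure_space_1)
  next
    case False
    define j where "j = nat \<lceil>real k * p / 2\<rceil>"
    have j: "real j < real k * p / 2 + 1" "real k * p / 2 \<le> real j"
      using p unfolding j_def by (auto simp: of_nat_nat) linarith+
    have "(\<integral>\<^sup>+x. residual k x \<partial>\<pi>) \<le> (\<integral>\<^sup>+x. ennreal ((1 - \<delta>) ^ j) + few_visits k j x \<partial>\<pi>)"
      by (intro nn_integral_mono residual_le_few_visits) (simp add: space_pi)
    also have "\<dots> = ennreal ((1 - \<delta>) ^ j) + (\<integral>\<^sup>+x. few_visits k j x \<partial>\<pi>)"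
      by (subst nn_integral_add) (auto simp: pi.emeasure_space_1)
    also have "\<dots> \<le> ennreal (exp (- (c * real k))) + ennreal (2 * exp (- (c * real k)))"
    proof (intro add_mono ennreal_leI)
      have "(1 - \<delta>) ^ j \<le> exp (- \<delta>) ^ j"
        using \<delta> exp_ge_add_one_self[of "- \<delta>"] by (intro power_mono) auto
      also have "\<dots> = exp (- (\<delta> * real j))" by (simp add: exp_of_nat_mult[symmetric] mult.commute)
      also have "\<dots> \<le> exp (- (c * real k))"
      proof -
        have "c * real k \<le> (\<delta> * p / 2) * real k" by (intro mult_right_mono) (auto simp: c_def)
        also have "\<dots> = \<delta> * (real k * p / 2)" by simp
        also have "\<dots> \<le> \<delta> * real j" using \<delta> j by (intro mult_left_mono) auto
        finally show ?thesis by simp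
      qed
      finally show "(1 - \<delta>) ^ j \<le> exp (- (c * real k))" .
      have "(\<integral>\<^sup>+x. few_visits k j x \<partial>\<pi>) \<le> ennreal (2 * exp (- (a * k)))"
        using False j by (intro tail) (auto simp: p_def)
      also have "\<dots> \<le> ennreal (2 * exp (- (c * real k)))"
        by (intro ennreal_leI) (auto simp: c_def mult_right_mono)
      finally show "(\<integral>\<^sup>+x. few_visits k j x \<partial>\<pi>) \<le> ennreal (2 * exp (- (c * real k)))" .
    qed
    also have "\<dots> = ennreal (3 * exp (- (c * real k)))"
      by (subst ennreal_plus[symmetric]) auto
    finally show ?thesis .
  qed
qed

end

subsection \<open>From regeneration to geometric ergodicity\<close>

context minorized_chain
begin

text \<open>Up to a regeneration the residual chain is dominated by the chain itself, and after it the
  chain restarts from \<open>\<nu>\<close>.\<close>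

lemma expect_ge_residual:
  assumes f[measurable]: "f \<in> borel_measurable M" and b: "b < \<infinity>"
    and x: "x \<in> space M"
    and lower: "\<And>i. i < n \<Longrightarrow> b \<le> (\<integral>\<^sup>+y. expect (m * (J + i)) f y \<partial>\<nu>)"
  shows "b \<le> expect (m * (J + n)) f x + b * residual n x"
  using x lower
proof (induction n arbitrary: x)
  case (Suc n)
  define s where "s = ennreal \<delta> * indicator C x"
  define r where "r = (\<integral>\<^sup>+y. residual n y \<partial>\<nu>)"
  have fin: "s * b + s * b * r < \<infinity>"
    using b nn_integral_residual_le_1[of n]
    by (auto simp: s_def r_def ennreal_mult_less_top indicator_def le_less_trans)
  define f' where "f' y = expect (m * (J + n)) f y + b * residual n y" for y
  have f'[measurable]: "f' \<in> borel_measurable M" unfolding f'_def by measurable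
  \<comment> \<open>\<open>Suc(3)[of n]\<close> handles a regeneration in the first step, after
    which time m (J + n) is left. With the induction hypothesis b \<le> f',
    \<open>residual_mono\<close> then applies to the constant b and f'; the finite amount s b + s b
    r is cancelled at the end.\<close>
  have "b + (s * b + s * b * r) \<le> b + s * (\<integral>\<^sup>+y. f' y \<partial>\<nu>)"
  proof -
    have "(\<integral>\<^sup>+y. f' y \<partial>\<nu>) = (\<integral>\<^sup>+y. expect (m * (J + n)) f y \<partial>\<nu>) + b * r"
      unfolding f'_def r_def
      by (subst nn_integral_add) (auto simp: nn_integral_cmult)
    then have "b + b * r \<le> (\<integral>\<^sup>+y. f' y \<partial>\<nu>)" using Suc(3)[of n] by (simp add: add_right_mono)
    then have "s * (b + b * r) \<le> s * (\<integral>\<^sup>+y. f' y \<partial>\<nu>)" by (rule mult_left_mono) simp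
    then show ?thesis by (simp add: distrib_left mult.assoc add_left_mono)
  qed
  also have "\<dots> = expect m (\<lambda>_. b) x + s * (\<integral>\<^sup>+y. f' y \<partial>\<nu>)" by (simp add: expect_const Suc(2))
  also have "\<dots> \<le> expect m f' x + s * (\<integral>\<^sup>+y. b \<partial>\<nu>)"
    unfolding s_def using Suc by (intro residual_mono) (auto simp: f'_def)
  also have "\<dots> = expect (m * (J + Suc n)) f x + b * expect m (residual n) x + s * b"
    unfolding f'_def using Suc(2)
    by (simp add: expect_add expect_cmult expect_expect nu.emeasure_space_1 add.assoc)
  also have "expect m (residual n) x = residual (Suc n) x + s * r"
    unfolding s_def r_def by (rule residual_Suc[OF Suc(2), symmetric])
  also have "expect (m * (J + Suc n)) f x + b * (residual (Suc n) x + s * r) + s * b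
    = (s * b + s * b * r) + (expect (m * (J + Suc n)) f x + b * residual (Suc n) x)"
    by (simp only: distrib_left ac_simps)
  finally have "(s * b + s * b * r) + b \<le> (s * b + s * b * r) + (expect (m * (J + Suc n)) f x + b * residual (Suc n) x)"
    by (subst add.commute)
  then show ?case using fin by (simp only: ennreal_add_left_cancel_le) auto
qed simp

text \<open>The time after which P^i(x, C) > 0 depends on x. The sets \<open>E j\<close> of points
  for which j works exhaust the space, so one of them has positive \<nu>-mass, and its index serves
  as \<open>J\<close>.\<close>

lemma eventually_nu_visits:
  obtains J where "\<And>i. i \<ge> J \<Longrightarrow> (\<integral>\<^sup>+y. expect i (indicator C) y \<partial>\<nu>) > 0"
proof -
  define E where "E j = {x \<in> space M. \<forall>i\<ge>j. expect i (indicator C) x > 0}" for j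
  have [measurable]: "expect i (indicator C) \<in> borel_measurable M" for i by measurable
  have E[measurable]: "E j \<in> sets M" for j unfolding E_def by measurable
  have "\<exists>j. emeasure \<nu> (E j) \<noteq> 0"
  proof (rule ccontr)
    assume "\<not> ?thesis"
    then have "emeasure \<nu> (\<Union>j. E j) = 0" by (intro emeasure_UN_eq_0) (auto simp: sets_nu)
    moreover have "space \<nu> \<subseteq> (\<Union>j. E j)"
    proof
      fix x assume "x \<in> space \<nu>"
      then have x: "x \<in> space M" by (simp add: space_nu)
      then show "x \<in> (\<Union>j. E j)"
        using eventually_visits[OF x C C_pos]
        by (auto simp: E_def eventually_sequentially expect_indicator)
    qed
    then have "emeasure \<nu> (space \<nu>) \<le> emeasure \<nu> (\<Union>j. E j)"
      by (intro emeasure_mono) (auto simp: sets_nu)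
    ultimately show False by (simp add: nu.emeasure_space_1)
  qed
  then obtain J where J: "emeasure \<nu> (E J) \<noteq> 0" by blast
  show thesis
  proof (rule that[of J])
    fix i assume i: "i \<ge> J"
    show "(\<integral>\<^sup>+y. expect i (indicator C) y \<partial>\<nu>) > 0"
    proof (rule ccontr)
      assume "\<not> ?thesis"
      then have "(\<integral>\<^sup>+y. expect i (indicator C) y \<partial>\<nu>) = 0" by (simp add: zero_less_iff_neq_zero)
      then have "AE y in \<nu>. expect i (indicator C) y = 0" by (subst (asm) nn_integral_0_iff_AE) auto
      then have "AE y in \<nu>. y \<notin> E J" by eventually_elim (use i in \<open>auto simp: E_def\<close>)
      then have "emeasure \<nu> (E J) = 0"
        using AE_iff_null_sets[of "E J" \<nu>] by (auto simp: sets_nu)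
      with J show False by simp
    qed
  qed
qed

text \<open>A regeneration occurs within n skeleton steps with probability at least 1/2, but at a
  varying time. The bound \<beta> covers all n possible remaining times, so that one total time q
  works for every x; the 1/2 reappears in \<epsilon> = \<delta> \<beta> / 2.\<close>

lemma small_of_residual_le_half:
  obtains q \<epsilon> where "0 < q" "0 < \<epsilon>" "\<epsilon> < 1"
    "\<And>x A. x \<in> space M \<Longrightarrow> residual n x \<le> ennreal (1 / 2) \<Longrightarrow> A \<in> sets M \<Longrightarrow>
      ennreal \<epsilon> * emeasure \<nu> A \<le> emeasure (kernel_power M P q x) A"
proof -
  obtain J where J: "\<And>i. i \<ge> J \<Longrightarrow> (\<integral>\<^sup>+y. expect i (indicator C) y \<partial>\<nu>) > 0"
    using eventually_nu_visits by blast
  define \<beta>' where "\<beta>' i = (\<integral>\<^sup>+y. expect (m * (J + i)) (indicator C) y \<partial>\<nu>)" for i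
  have \<beta>'_pos: "\<beta>' i > 0" for i
  proof -
    have "J \<le> m * (J + i)" using m by (cases m) auto
    then show ?thesis unfolding \<beta>'_def by (rule J)
  qed
  have \<beta>'_le: "\<beta>' i \<le> 1" for i
  proof -
    have "\<beta>' i \<le> (\<integral>\<^sup>+y. 1 \<partial>\<nu>)" unfolding \<beta>'_def
    proof (intro nn_integral_mono)
      fix y assume "y \<in> space \<nu>"
      then have y: "y \<in> space M" by (simp add: space_nu)
      then show "expect (m * (J + i)) (indicator C) y \<le> 1"
        using prob_space.emeasure_le_1[OF prob_space_kernel_power[OF y]] by (simp add: expect_indicator)
    qed
    then show ?thesis by (simp add: nu.emeasure_space_1)
  qed
  \<comment> \<open>Inserting 1 keeps the minimum meaningful for \<open>n = 0\<close> and gives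
    \<beta> \<le> 1.\<close>
  define \<beta> where "\<beta> = Min (insert 1 ((\<lambda>i. enn2real (\<beta>' i)) ` {..<n}))"
  have \<beta>: "\<beta> > 0" "\<beta> \<le> 1"
    using \<beta>'_pos le_less_trans[OF \<beta>'_le ennreal_one_less_top]
    by (auto simp: \<beta>_def enn2real_positive_iff)
  have \<beta>_le: "ennreal \<beta> \<le> \<beta>' i" if "i < n" for i
  proof -
    have "\<beta> \<le> enn2real (\<beta>' i)" unfolding \<beta>_def using that by (intro Min_le) auto
    then have "ennreal \<beta> \<le> ennreal (enn2real (\<beta>' i))" by (rule ennreal_leI)
    also have "\<dots> = \<beta>' i" using le_less_trans[OF \<beta>'_le ennreal_one_less_top] by simp
    finally show ?thesis .
  qed
  show thesis
  proof (rule that[of "m * (Suc J + n)" "\<delta> * \<beta> / 2"])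
    show "0 < m * (Suc J + n)" using m by simp
    show "0 < \<delta> * \<beta> / 2" using \<delta> \<beta> by simp
    have "\<delta> * \<beta> \<le> 1 * 1" using \<delta> \<beta> by (intro mult_mono) auto
    then show "\<delta> * \<beta> / 2 < 1" by simp
    fix x A assume x: "x \<in> space M" and half: "residual n x \<le> ennreal (1 / 2)" and A[measurable]: "A \<in> sets M"
    define r where "r = \<delta> * \<beta> * measure \<nu> A"
    have r: "r \<ge> 0" using \<delta> \<beta> by (simp add: r_def)
    define q where "q = measure (kernel_power M P (m * (Suc J + n)) x) A"
    have kp: "emeasure (kernel_power M P (m * (Suc J + n)) x) A = ennreal q"
      unfolding q_def
      by (intro finite_measure.emeasure_eq_measure prob_space.finite_measure prob_space_kernel_power x)
    \<comment> \<open>\<open>expect_ge_residual\<close> is used with \<open>Suc J\<close> for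
      \<open>J\<close>: from \<nu> the chain is in \<open>C\<close> at time m (J + i) with
      probability at least \<beta>, and the extra m steps are the minorized move from
      \<open>C\<close> into \<open>A\<close>.\<close>
    have "ennreal r \<le> expect (m * (Suc J + n)) (indicator A) x + ennreal r * residual n x"
    proof (rule expect_ge_residual)
      fix i assume i: "i < n"
      have "ennreal r = ennreal \<beta> * (ennreal \<delta> * emeasure \<nu> A)"
        using \<delta> \<beta> by (simp add: r_def nu.emeasure_eq_measure ennreal_mult[symmetric] ac_simps)
      also have "\<dots> \<le> \<beta>' i * (ennreal \<delta> * emeasure \<nu> A)"
        by (intro mult_right_mono \<beta>_le i) simp
      also have "\<dots> = (\<integral>\<^sup>+y. expect (m * (J + i)) (indicator C) y * (ennreal \<delta> * emeasure \<nu> A) \<partial>\<nu>)"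
        unfolding \<beta>'_def by (rule nn_integral_multc[symmetric]) measurable
      also have "\<dots> \<le> (\<integral>\<^sup>+y. expect (m * (Suc J + i)) (indicator A) y \<partial>\<nu>)"
      proof (intro nn_integral_mono)
        fix y assume "y \<in> space \<nu>"
        then have y: "y \<in> space M" by (simp add: space_nu)
        have "expect (m * (J + i)) (indicator C) y * (ennreal \<delta> * emeasure \<nu> A)
            = expect (m * (J + i)) (\<lambda>z. ennreal \<delta> * emeasure \<nu> A * indicator C z) y"
          using y by (subst expect_cmult) (auto simp: ac_simps)
        also have "\<dots> \<le> expect (m * (J + i)) (expect m (indicator A)) y"
        proof (intro expect_mono y)
          fix z assume z: "z \<in> space M"
          have "ennreal \<delta> * indicator C z * (\<integral>\<^sup>+y. indicator A y \<partial>\<nu>) \<le> expect m (indicator A) z"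
            by (rule minorization_nn_integral[OF z]) measurable
          then show "ennreal \<delta> * emeasure \<nu> A * indicator C z \<le> expect m (indicator A) z"
            by (simp add: sets_nu ac_simps)
        qed
        also have "\<dots> = expect (m * (Suc J + i)) (indicator A) y"
          using y by (simp add: expect_expect add.commute)
        finally show "expect (m * (J + i)) (indicator C) y * (ennreal \<delta> * emeasure \<nu> A)
          \<le> expect (m * (Suc J + i)) (indicator A) y" .
      qed
      finally show "ennreal r \<le> (\<integral>\<^sup>+y. expect (m * (Suc J + i)) (indicator A) y \<partial>\<nu>)" .
    qed (use x in auto)
    also have "\<dots> \<le> ennreal q + ennreal r * ennreal (1 / 2)"
      unfolding expect_indicator[OF x A] kp by (intro add_left_mono mult_left_mono half) simp
    also have "\<dots> = ennreal (q + r * (1 / 2))"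
    proof -
      have "ennreal (r * (1 / 2)) = ennreal r * ennreal (1 / 2)" using r by (intro ennreal_mult) auto
      moreover have "ennreal (q + r * (1 / 2)) = ennreal q + ennreal (r * (1 / 2))"
        using r by (intro ennreal_plus) (auto simp: q_def)
      ultimately show ?thesis by simp
    qed
    finally have "r \<le> q + r * (1 / 2)" using r by (subst (asm) ennreal_le_iff) (auto simp: q_def)
    then have "ennreal (\<delta> * \<beta> / 2 * measure \<nu> A) \<le> ennreal q"
      by (intro ennreal_leI) (simp add: r_def)
    then show "ennreal (\<delta> * \<beta> / 2) * emeasure \<nu> A \<le> emeasure (kernel_power M P (m * (Suc J + n)) x) A"
      unfolding kp using \<delta> \<beta> by (simp add: nu.emeasure_eq_measure ennreal_mult[symmetric])
  qed
qed

text \<open>Stationarity gives \<open>\<pi> = \<pi> P\<^sup>m \<ge> \<delta> \<pi>(C) \<nu>\<close>.\<close>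

lemma nn_integral_nu_finite:
  assumes f[measurable]: "f \<in> borel_measurable M" and fin: "(\<integral>\<^sup>+x. f x \<partial>\<pi>) < \<infinity>"
  shows "(\<integral>\<^sup>+x. f x \<partial>\<nu>) < \<infinity>"
proof -
  have "(ennreal \<delta> * emeasure \<pi> C) * (\<integral>\<^sup>+y. f y \<partial>\<nu>)
      = (\<integral>\<^sup>+x. ennreal \<delta> * (\<integral>\<^sup>+y. f y \<partial>\<nu>) * indicator C x \<partial>\<pi>)"
    by (subst nn_integral_cmult_indicator) (auto simp: sets_pi ac_simps)
  also have "\<dots> \<le> (\<integral>\<^sup>+x. expect m f x \<partial>\<pi>)"
  proof (intro nn_integral_mono)
    fix x assume "x \<in> space \<pi>"
    then show "ennreal \<delta> * (\<integral>\<^sup>+y. f y \<partial>\<nu>) * indicator C x \<le> expect m f x"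
      using minorization_nn_integral[of x f] by (simp add: space_pi ac_simps)
  qed
  also have "\<dots> = (\<integral>\<^sup>+x. f x \<partial>\<pi>)" by (rule nn_integral_stationary) measurable
  finally have "(ennreal \<delta> * emeasure \<pi> C) * (\<integral>\<^sup>+y. f y \<partial>\<nu>) < \<infinity>" using fin by simp
  moreover have "ennreal \<delta> * emeasure \<pi> C \<noteq> 0" using \<delta> C_pos by simp
  ultimately show ?thesis by (auto simp: ennreal_mult_less_top)
qed

section \<open>The drift function and its small sublevel set\<close>

lemma geometrically_ergodic_of_residual_tail:
  assumes c: "c > 0" and tail: "\<And>k. (\<integral>\<^sup>+x. residual k x \<partial>\<pi>) \<le> ennreal (3 * exp (- (c * real k)))"
  shows "geometrically_ergodic M P"
proof -
  \<comment> \<open>Half of the tail rate, so that the sum of \<kappa>^k 3 exp(-c k)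
    converges.\<close>
  define \<kappa> where "\<kappa> = exp (c / 2)"
  \<comment> \<open>g^2 is the m-th root of \<kappa>. One factor g will absorb the constant
    \<open>b\<close> outside the sublevel set; the other is the rate for the return time.\<close>
  define g where "g = exp (c / (4 * real m))"
  have g: "g > 1" using c m by (simp add: g_def)
  have g_pow: "(g * g) ^ m = \<kappa>"
  proof -
    have "(g * g) ^ m = exp (real m * (c / (4 * real m) + c / (4 * real m)))"
      by (simp only: g_def exp_add[symmetric] exp_of_nat_mult)
    also have "real m * (c / (4 * real m) + c / (4 * real m)) = c / 2" using m by (simp add: field_simps)
    finally show ?thesis by (simp add: \<kappa>_def)
  qed
  have \<kappa>: "\<kappa> > 1" using c by (simp add: \<kappa>_def)
  \<comment> \<open>If T is the number of skeleton steps up to and including the regeneration,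
    \<open>residual k\<close> is the probability of T > k, so h x is the expectation of (\<kappa>^T
    - 1) / (\<kappa> - 1).\<close>
  define h where "h x = (\<Sum>k. ennreal (\<kappa> ^ k) * residual k x)" for x
  have h[measurable]: "h \<in> borel_measurable M" unfolding h_def by measurable
  have h_ge: "ennreal (\<kappa> ^ k) * residual k x \<le> h x" for k x
  proof -
    have "ennreal (\<kappa> ^ k) * residual k x = (\<Sum>k\<in>{k}. ennreal (\<kappa> ^ k) * residual k x)" by simp
    also have "\<dots> \<le> h x" unfolding h_def by (rule sum_le_suminf[OF summableI]) auto
    finally show ?thesis .
  qed
  have h_fin: "(\<integral>\<^sup>+x. h x \<partial>\<pi>) < \<infinity>"
  proof -
    have "(\<integral>\<^sup>+x. h x \<partial>\<pi>) = (\<Sum>k. \<integral>\<^sup>+x. ennreal (\<kappa> ^ k) * residual k x \<partial>\<pi>)"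
      unfolding h_def by (rule nn_integral_suminf) measurable
    also have "\<dots> = (\<Sum>k. ennreal (\<kappa> ^ k) * (\<integral>\<^sup>+x. residual k x \<partial>\<pi>))"
      by (intro suminf_cong nn_integral_cmult) measurable
    also have "\<dots> \<le> (\<Sum>k. ennreal (3 * exp (- (c / 2)) ^ k))"
    proof (intro suminf_le summableI)
      fix k
      have "ennreal (\<kappa> ^ k) * (\<integral>\<^sup>+x. residual k x \<partial>\<pi>) \<le> ennreal (\<kappa> ^ k) * ennreal (3 * exp (- (c * real k)))"
        by (intro mult_left_mono tail) simp
      also have "\<dots> = ennreal (\<kappa> ^ k * (3 * exp (- (c * real k))))"
        using \<kappa> by (intro ennreal_mult[symmetric]) auto
      also have "\<kappa> ^ k * (3 * exp (- (c * real k))) = 3 * exp (- (c / 2)) ^ k"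
        by (simp add: \<kappa>_def exp_of_nat_mult[symmetric] exp_add[symmetric] algebra_simps)
      finally show "ennreal (\<kappa> ^ k) * (\<integral>\<^sup>+x. residual k x \<partial>\<pi>) \<le> ennreal (3 * exp (- (c / 2)) ^ k)" .
    qed
    also have "\<dots> = ennreal (\<Sum>k. 3 * exp (- (c / 2)) ^ k)"
      using c by (intro suminf_ennreal2 summable_mult summable_geometric) auto
    also have "\<dots> < \<infinity>" by simp
    finally show ?thesis .
  qed
  \<comment> \<open>Applying \<kappa> P^m to the series h shifts its index by one, which costs
    nothing, and adds the regeneration term \<kappa> \<delta> 1_C \<nu>(h), which is at most
    \<open>b\<close>.\<close>
  define b where "b = ennreal \<kappa> * (ennreal \<delta> * (\<integral>\<^sup>+y. h y \<partial>\<nu>))"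
  have "b < \<infinity>" using nn_integral_nu_finite[OF h h_fin] by (simp add: b_def ennreal_mult_less_top)
  then obtain b' where b': "b = ennreal b'" "b' \<ge> 0" by (cases b) auto
  have h_drift: "ennreal \<kappa> * expect m h x \<le> h x + b" if x: "x \<in> space M" for x
  proof -
    let ?s = "ennreal \<delta> * indicator C x"
    have "expect m h x = (\<Sum>k. expect m (\<lambda>y. ennreal (\<kappa> ^ k) * residual k y) x)"
      unfolding h_def using x by (intro expect_suminf) auto
    also have "\<dots> = (\<Sum>k. ennreal (\<kappa> ^ k) * residual (Suc k) x + ?s * (ennreal (\<kappa> ^ k) * (\<integral>\<^sup>+y. residual k y \<partial>\<nu>)))"
    proof (intro suminf_cong)
      fix k
      have "expect m (\<lambda>y. ennreal (\<kappa> ^ k) * residual k y) x = ennreal (\<kappa> ^ k) * expect m (residual k) x"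
        using x by (intro expect_cmult) auto
      also have "\<dots> = ennreal (\<kappa> ^ k) * (residual (Suc k) x + ?s * (\<integral>\<^sup>+y. residual k y \<partial>\<nu>))"
        by (simp only: residual_Suc[OF x])
      finally show "expect m (\<lambda>y. ennreal (\<kappa> ^ k) * residual k y) x
          = ennreal (\<kappa> ^ k) * residual (Suc k) x + ?s * (ennreal (\<kappa> ^ k) * (\<integral>\<^sup>+y. residual k y \<partial>\<nu>))"
        by (simp only: distrib_left ac_simps)
    qed
    also have "\<dots> = (\<Sum>k. ennreal (\<kappa> ^ k) * residual (Suc k) x) + (\<Sum>k. ?s * (ennreal (\<kappa> ^ k) * (\<integral>\<^sup>+y. residual k y \<partial>\<nu>)))"
      by (intro suminf_add[symmetric] summableI)
    also have "(\<Sum>k. ?s * (ennreal (\<kappa> ^ k) * (\<integral>\<^sup>+y. residual k y \<partial>\<nu>))) = ?s * (\<integral>\<^sup>+y. h y \<partial>\<nu>)"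
    proof -
      have "(\<integral>\<^sup>+y. h y \<partial>\<nu>) = (\<Sum>k. \<integral>\<^sup>+y. ennreal (\<kappa> ^ k) * residual k y \<partial>\<nu>)"
        unfolding h_def by (rule nn_integral_suminf) measurable
      also have "\<dots> = (\<Sum>k. ennreal (\<kappa> ^ k) * (\<integral>\<^sup>+y. residual k y \<partial>\<nu>))"
        by (intro suminf_cong nn_integral_cmult) measurable
      finally show ?thesis by simp
    qed
    finally have "ennreal \<kappa> * expect m h x = (\<Sum>k. ennreal \<kappa> * (ennreal (\<kappa> ^ k) * residual (Suc k) x)) + ennreal \<kappa> * (?s * (\<integral>\<^sup>+y. h y \<partial>\<nu>))"
      by (simp only: distrib_left ennreal_suminf_cmult)
    also have "(\<Sum>k. ennreal \<kappa> * (ennreal (\<kappa> ^ k) * residual (Suc k) x)) = (\<Sum>k. ennreal (\<kappa> ^ Suc k) * residual (Suc k) x)"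
      using \<kappa> by (intro suminf_cong) (simp add: ennreal_mult mult.assoc del: residual.simps)
    also have "\<dots> \<le> h x" unfolding h_def by (rule suminf_Suc_le)
    also have "ennreal \<kappa> * (?s * (\<integral>\<^sup>+y. h y \<partial>\<nu>)) \<le> b"
      unfolding b_def by (intro mult_left_mono mult_right_mono) (auto simp: indicator_def)
    finally show ?thesis by (simp add: add_mono)
  qed
  let ?g = "\<lambda>j. ennreal ((g * g) ^ j)"
  \<comment> \<open>As g^(2m) = \<kappa>, the sum telescopes: h + g^2 P V = V + \<kappa> P^m h.
    Where V is finite, h can be cancelled, and the m-step drift of h becomes a one-step drift of V
    with the same \<open>b\<close>.\<close>
  define V where "V x = (\<Sum>j<m. ?g j * expect j h x)" for x
  have V[measurable]: "V \<in> borel_measurable M" unfolding V_def by measurable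
  have hV: "h x \<le> V x" if x: "x \<in> space M" for x
  proof -
    have "h x = (\<Sum>j\<in>{0}. ?g j * expect j h x)" using x by (simp add: expect_0)
    also have "\<dots> \<le> V x" unfolding V_def using m by (intro sum_mono2) auto
    finally show ?thesis .
  qed
  have V1: "1 \<le> V x" if x: "x \<in> space M" for x
    using h_ge[of 0 x] hV[OF x] by simp
  have V_drift: "ennreal (g * g) * expect 1 V x \<le> V x + b" if x: "x \<in> space M" for x
  proof (cases "V x = \<infinity>")
    case False
    then have hx: "h x < \<infinity>" using hV[OF x] by (auto simp: less_top[symmetric] top_unique)
    have "expect 1 V x = (\<Sum>j<m. expect 1 (\<lambda>y. ?g j * expect j h y) x)"
      unfolding V_def using x by (intro expect_sum) auto
    also have "\<dots> = (\<Sum>j<m. ?g j * expect (Suc j) h x)"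
      using x by (intro sum.cong) (auto simp: expect_cmult expect_expect)
    finally have "ennreal (g * g) * expect 1 V x = (\<Sum>j<m. ?g (Suc j) * expect (Suc j) h x)"
      using g by (simp add: sum_distrib_left ennreal_mult mult.assoc)
    then have "h x + ennreal (g * g) * expect 1 V x = ?g 0 * expect 0 h x + (\<Sum>j<m. ?g (Suc j) * expect (Suc j) h x)"
      using x by (simp add: expect_0)
    also have "\<dots> = (\<Sum>j<Suc m. ?g j * expect j h x)" by (rule sum.lessThan_Suc_shift[symmetric])
    also have "\<dots> = V x + ennreal \<kappa> * expect m h x" by (simp add: V_def g_pow)
    also have "\<dots> \<le> V x + (h x + b)" by (intro add_left_mono h_drift x)
    also have "\<dots> = h x + (V x + b)" by (simp only: ac_simps)
    finally show ?thesis using hx by (simp only: ennreal_add_left_cancel_le) auto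
  qed simp
  have "\<exists>x\<in>space M. V x < \<infinity>"
  proof (rule ccontr)
    assume "\<not> ?thesis"
    then have "(\<integral>\<^sup>+x. V x \<partial>\<pi>) = (\<integral>\<^sup>+x. \<infinity> \<partial>\<pi>)"
      by (intro nn_integral_cong) (auto simp: space_pi less_top[symmetric])
    then have "(\<integral>\<^sup>+x. V x \<partial>\<pi>) = \<infinity>" by (simp add: pi.emeasure_space_1)
    moreover have "(\<integral>\<^sup>+x. V x \<partial>\<pi>) = (\<Sum>j<m. ?g j * (\<integral>\<^sup>+x. h x \<partial>\<pi>))"
      unfolding V_def by (simp add: nn_integral_sum nn_integral_cmult nn_integral_stationary)
    ultimately show False using h_fin by (auto simp: ennreal_mult_eq_top_iff)
  qed
  then obtain x0 v0 where x0: "x0 \<in> space M" "V x0 = ennreal v0" "v0 \<ge> 0"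
    by (metis ennreal_cases less_irrefl infinity_ennreal_def)
  \<comment> \<open>\<open>v0\<close> makes the sublevel set nonempty. The other entry gives b \<le>
    (g - 1) N \<le> (g - 1) V outside it, hence V + b \<le> g V.\<close>
  define N where "N = max v0 (b' / (g - 1))"
  have N: "N \<ge> 0" "v0 \<le> N" "b' \<le> (g - 1) * N"
    using g x0 b' by (auto simp: N_def max_def field_simps)
  define D where "D = {x \<in> space M. V x \<le> ennreal N}"
  have D[measurable]: "D \<in> sets M" unfolding D_def by measurable
  have "x0 \<in> D" using x0 N by (simp add: D_def ennreal_leI)
  have off: "ennreal g * expect 1 V y \<le> V y" if "y \<in> space M" "y \<notin> D" for y
  proof -
    have VN: "ennreal N \<le> V y" using that by (auto simp: D_def)
    have "ennreal g * (ennreal g * expect 1 V y) \<le> V y + b"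
      using V_drift[OF that(1)] g by (simp add: ennreal_mult mult.assoc)
    also have "b \<le> ennreal ((g - 1) * N)" unfolding b' by (intro ennreal_leI N)
    also have "\<dots> = ennreal (g - 1) * ennreal N" using g N by (intro ennreal_mult) auto
    also have "\<dots> \<le> ennreal (g - 1) * V y" by (intro mult_left_mono VN) simp
    also have "V y + ennreal (g - 1) * V y = (ennreal 1 + ennreal (g - 1)) * V y"
      by (simp add: distrib_right)
    also have "ennreal 1 + ennreal (g - 1) = ennreal g" using g by (subst ennreal_plus[symmetric]) auto
    finally have "ennreal g * (ennreal g * expect 1 V y) \<le> ennreal g * V y" by (simp add: add_left_mono)
    then show ?thesis using g by (subst (asm) ennreal_mult_le_mult_iff) auto
  qed
  have ret: "(\<integral>\<^sup>+\<omega>. power_enat g (return_time D \<omega>) \<partial>chain_law_from M P x) \<le> ennreal N + b" if "x \<in> D" for x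
  proof -
    have x: "x \<in> space M" using that by (simp add: D_def)
    have "(\<integral>\<^sup>+\<omega>. power_enat g (return_time D \<omega>) \<partial>chain_law_from M P x) \<le> ennreal g * expect 1 V x"
      by (rule return_time_bound[OF x D V V1 g off])
    also have "\<dots> \<le> ennreal (g * g) * expect 1 V x" using g by (intro mult_right_mono ennreal_leI) auto
    also have "\<dots> \<le> V x + b" by (rule V_drift[OF x])
    also have "\<dots> \<le> ennreal N + b" using that by (intro add_right_mono) (simp add: D_def)
    finally show ?thesis .
  qed
  \<comment> \<open>On \<open>D\<close>, \<kappa>^n \<open>residual n\<close> \<le> h \<le> V \<le>
    N < \<kappa>^n / 2, so n skeleton steps bring a regeneration with probability at least
    1/2.\<close>
  obtain n where n: "2 * N < \<kappa> ^ n" using real_arch_pow[OF \<kappa>] by blast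
  have half: "residual n x \<le> ennreal (1 / 2)" if "x \<in> D" for x
  proof -
    have x: "x \<in> space M" using that by (simp add: D_def)
    obtain r where r: "residual n x = ennreal r" "r \<ge> 0"
      using residual_le_1[OF x, of n] by (cases "residual n x") (auto simp: top_unique)
    have "ennreal (\<kappa> ^ n) * residual n x \<le> ennreal N"
      using h_ge[of n x] hV[OF x] that by (auto simp: D_def)
    then have "\<kappa> ^ n * r \<le> N" using \<kappa> r N by (simp add: ennreal_mult[symmetric])
    then have "\<kappa> ^ n * r \<le> \<kappa> ^ n * (1 / 2)" using n by simp
    then have "r \<le> 1 / 2" using \<kappa> by (subst (asm) mult_le_cancel_left_pos) auto
    then show ?thesis unfolding r by (rule ennreal_leI)
  qed
  obtain q \<epsilon> where q: "0 < q" "0 < \<epsilon>" "\<epsilon> < 1" and small: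
    "\<And>x A. x \<in> space M \<Longrightarrow> residual n x \<le> ennreal (1 / 2) \<Longrightarrow> A \<in> sets M \<Longrightarrow>
      ennreal \<epsilon> * emeasure \<nu> A \<le> emeasure (kernel_power M P q x) A"
    using small_of_residual_le_half by blast
  have "(SUP x\<in>D. \<integral>\<^sup>+\<omega>. power_enat g (return_time D \<omega>) \<partial>chain_law_from M P x) \<le> ennreal N + b"
    by (rule SUP_least) (rule ret)
  also have "\<dots> < \<infinity>" using b' by simp
  finally have sup: "(SUP x\<in>D. \<integral>\<^sup>+\<omega>. power_enat g (return_time D \<omega>) \<partial>chain_law_from M P x) < \<infinity>" .
  have "\<forall>x\<in>D. \<forall>A\<in>sets M. ennreal \<epsilon> * emeasure \<nu> A \<le> emeasure (kernel_power M P q x) A"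
    using small half by (auto simp: D_def)
  with D \<open>x0 \<in> D\<close> q \<nu> g sup positive show ?thesis
    unfolding geometrically_ergodic_def by blast
qed

end

theorem mainTheorem2:
  fixes M :: "'a measure" and P :: "'a \<Rightarrow> 'a measure" and \<pi> :: "'a measure" and M\<^sub>0 :: real
  assumes "countably_generated_space M"
    and "P \<in> M \<rightarrow>\<^sub>M prob_algebra M"
    and "irreducible_aperiodic_positive M P \<pi>"
    and "M\<^sub>0 > 0"
    and "\<And>(n::nat) (K :: (nat \<Rightarrow> 'a) \<Rightarrow> real) (L :: nat \<Rightarrow> real) (t::real).
      K \<in> borel_measurable (PiM {..<n} (\<lambda>_. M)) \<Longrightarrow>
      (\<forall>i<n. L i \<ge> 0) \<Longrightarrow>
      separately_bounded M n K L \<Longrightarrow>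
      t > 0 \<Longrightarrow>
      measure (chain_law M P \<pi>)
        {\<omega> \<in> space (chain_law M P \<pi>).
          \<bar>K (restrict \<omega> {..<n}) - (\<integral>\<omega>'. K (restrict \<omega>' {..<n}) \<partial>chain_law M P \<pi>)\<bar> > t}
      \<le> (if (\<Sum>i<n. (L i)\<^sup>2) = 0 then 0
         else 2 * exp (- (inverse M\<^sub>0 * t\<^sup>2 / (\<Sum>i<n. (L i)\<^sup>2))))"
  shows "geometrically_ergodic M P"
proof -
  interpret positive_chain M P \<pi>
    by unfold_locales (fact assms)+
  obtain C m \<nu> \<delta> where small: "C \<in> sets M" "emeasure \<pi> C > 0" "0 < m" "\<nu> \<in> space (prob_algebra M)"
    "0 < \<delta>" "\<delta> < 1"
    "\<And>x A. x \<in> C \<Longrightarrow> A \<in> sets M \<Longrightarrow> ennreal \<delta> * emeasure \<nu> A \<le> emeasure (kernel_power M P m x) A"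
    by (rule exists_small_set[OF assms(1)]) (rule that)
  interpret minorized_chain M P \<pi> C m \<nu> \<delta>
    by unfold_locales (fact small)+
  have "measure \<pi> C > 0" using small(2) by (simp add: pi.emeasure_eq_measure)
  then have "inverse M\<^sub>0 * (measure \<pi> C)\<^sup>2 / 4 > 0" using assms(4) by simp
  then obtain c where "c > 0" "\<And>k. (\<integral>\<^sup>+x. residual k x \<partial>\<pi>) \<le> ennreal (3 * exp (- (c * real k)))"
    by (rule residual_tail) (rule few_visits_tail[OF assms(4,5)], assumption+, rule that)
  then show ?thesis by (rule geometrically_ergodic_of_residual_tail)
qed

end
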